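(* Let $k\geq2$ be an integer. The pull-back map of $\underline{\phi_k}:\mathbb{R}^2/G\to A_{2k}$ is a Poisson morphism $$C^\infty(\mathbb{R}^3)\to C^{\lfloor k/2\rfloor}(\mathbb{R}^2/G).$$ It restricts to a Poisson algebra isomorphism $\underline{\phi_k}^*:\mathcal{F}(A_{2k})\simeq\mathcal{A}$.
   Context: $\mathbb{R}^2$ has coordinates $(p,q)$ and Poisson bracket determined by $\{p,q\}=\frac{q}{2\pi}$. $G\simeq\mathbb{Z}$ acts by $n\cdot(p,q)=(p+nq,q)$, and $\mathbb{R}^2/G$ is the quotient of $\mathbb{R}^2$ by the closed equivalence relation $(p,q)\sim(p+nq,q)$ for $n\in\mathbb{Z}$, $(p,0)\sim(p',0)$ for all $p,p'\in\mathbb{R}$. Functions on $\mathbb{R}^2/G$ are identified with $G$-invariant functions on $\mathbb{R}^2$; here $C^{\lfloor k/2\rfloor}(\mathbb{R}^2/G)$ denotes the algebra of $G$-invariant functions on $\mathbb{R}^2$ which are $\lfloor k/2\rfloor$ times differentiable on $\mathbb{R}^2$ and smooth outside the line $q=0$, with the bracket induced from $\mathbb{R}^2$. The map $\phi_k:\mathbb{R}^2\to\mathbb{R}^3$ is $\phi_k(p,q)=\left(q^k\cos\frac{2\pi p}{q},\,q^k\sin\frac{2\pi p}{q},\,q\right)$ for $q\neq0$, $\phi_k(p,0)=(0,0,0)$; it takes values in $A_{2k}=\{(x,y,z)\in\mathbb{R}^3: x^2+y^2=z^{2k}\}$ and induces $\underline{\phi_k}:\mathbb{R}^2/G\to A_{2k}\subset\mathbb{R}^3$.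 $\mathcal{A}$ is the algebra of functions on $\mathbb{R}^2/G$ generated by the three components $x(p,q)=q^k\cos\frac{2\pi p}{q}$, $y(p,q)=q^k\sin\frac{2\pi p}{q}$, $z(p,q)=q$ of $\phi_k$, with the bracket induced from $\mathbb{R}^2$. $C^\infty(\mathbb{R}^3)$ carries the Poisson bracket $\{x,y\}=\frac{\partial F}{\partial z}$, $\{y,z\}=\frac{\partial F}{\partial x}$, $\{z,x\}=\frac{\partial F}{\partial y}$ with $F=x^2+y^2-z^{2k}$, that is, $\{x,y\}=-2kz^{2k-1}$, $\{y,z\}=2x$, $\{z,x\}=2y$. The function $F$ is a Casimir, so the bracket descends to $\mathcal{F}(A_{2k})=\mathbb{R}[x,y,z]/(x^2+y^2-z^{2k})$, the algebra of polynomial functions on $A_{2k}$.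
   Formalization: The bracket on functions on R^2/G is multiplied by 2 (i.e. {p,q}=q/π), because with {p,q}=q/(2π) one gets {z,x}=y, not 2y; the target C^{⌊k/2⌋}(R^2/G) is taken as an algebra with a bracket operation, as it is not closed under the bracket. *)

theory Defs
  imports
    "HOL-Analysis.Analysis"
    "HOL-Computational_Algebra.Polynomial"
    "HOL-Algebra.QuotRing"
    "HOL-Algebra.Module"
begin

section \<open>Poisson algebras\<close>

record ('a, 'b) poisson = "('a, 'b) module" +
  pbracket :: "'b \<Rightarrow> 'b \<Rightarrow> 'b"  ("\<lbrace>_,/ _\<rbrace>\<index>")

locale poisson_algebra = algebra R M for R (structure) and M (structure) +
  assumes bracket_closed:
      "\<lbrakk>a \<in> carrier M; b \<in> carrier M\<rbrakk> \<Longrightarrow> \<lbrace>a, b\<rbrace>\<^bsub>M\<^esub> \<in> carrier M"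
    and bracket_add_left:
      "\<lbrakk>a \<in> carrier M; b \<in> carrier M; c \<in> carrier M\<rbrakk>
        \<Longrightarrow> \<lbrace>a \<oplus>\<^bsub>M\<^esub> b, c\<rbrace>\<^bsub>M\<^esub> = \<lbrace>a, c\<rbrace>\<^bsub>M\<^esub> \<oplus>\<^bsub>M\<^esub> \<lbrace>b, c\<rbrace>\<^bsub>M\<^esub>"
    and bracket_add_right:
      "\<lbrakk>a \<in> carrier M; b \<in> carrier M; c \<in> carrier M\<rbrakk>
        \<Longrightarrow> \<lbrace>a, b \<oplus>\<^bsub>M\<^esub> c\<rbrace>\<^bsub>M\<^esub> = \<lbrace>a, b\<rbrace>\<^bsub>M\<^esub> \<oplus>\<^bsub>M\<^esub> \<lbrace>a, c\<rbrace>\<^bsub>M\<^esub>"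
    and bracket_smult_left:
      "\<lbrakk>r \<in> carrier R; a \<in> carrier M; b \<in> carrier M\<rbrakk>
        \<Longrightarrow> \<lbrace>r \<odot>\<^bsub>M\<^esub> a, b\<rbrace>\<^bsub>M\<^esub> = r \<odot>\<^bsub>M\<^esub> \<lbrace>a, b\<rbrace>\<^bsub>M\<^esub>"
    and bracket_smult_right:
      "\<lbrakk>r \<in> carrier R; a \<in> carrier M; b \<in> carrier M\<rbrakk>
        \<Longrightarrow> \<lbrace>a, r \<odot>\<^bsub>M\<^esub> b\<rbrace>\<^bsub>M\<^esub> = r \<odot>\<^bsub>M\<^esub> \<lbrace>a, b\<rbrace>\<^bsub>M\<^esub>"
    and bracket_alternating:
      "a \<in> carrier M \<Longrightarrow> \<lbrace>a, a\<rbrace>\<^bsub>M\<^esub> = \<zero>\<^bsub>M\<^esub>"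
    and bracket_jacobi:
      "\<lbrakk>a \<in> carrier M; b \<in> carrier M; c \<in> carrier M\<rbrakk>
        \<Longrightarrow> \<lbrace>a, \<lbrace>b, c\<rbrace>\<^bsub>M\<^esub>\<rbrace>\<^bsub>M\<^esub> \<oplus>\<^bsub>M\<^esub> \<lbrace>b, \<lbrace>c, a\<rbrace>\<^bsub>M\<^esub>\<rbrace>\<^bsub>M\<^esub> \<oplus>\<^bsub>M\<^esub> \<lbrace>c, \<lbrace>a, b\<rbrace>\<^bsub>M\<^esub>\<rbrace>\<^bsub>M\<^esub> = \<zero>\<^bsub>M\<^esub>"
    and bracket_leibniz:
      "\<lbrakk>a \<in> carrier M; b \<in> carrier M; c \<in> carrier M\<rbrakk>
        \<Longrightarrow> \<lbrace>a, b \<otimes>\<^bsub>M\<^esub> c\<rbrace>\<^bsub>M\<^esub> = \<lbrace>a, b\<rbrace>\<^bsub>M\<^esub> \<otimes>\<^bsub>M\<^esub> c \<oplus>\<^bsub>M\<^esub> b \<otimes>\<^bsub>M\<^esub> \<lbrace>a, c\<rbrace>\<^bsub>M\<^esub>"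

definition poisson_hom ::
  "('r, 's) ring_scheme \<Rightarrow> ('r, 'a, 'm) poisson_scheme \<Rightarrow> ('r, 'b, 'n) poisson_scheme \<Rightarrow> ('a \<Rightarrow> 'b) set"
  where "poisson_hom R A B = {h \<in> ring_hom A B.
    (\<forall>r\<in>carrier R. \<forall>a\<in>carrier A. h (r \<odot>\<^bsub>A\<^esub> a) = r \<odot>\<^bsub>B\<^esub> h a) \<and>
    (\<forall>a\<in>carrier A. \<forall>b\<in>carrier A. h (\<lbrace>a, b\<rbrace>\<^bsub>A\<^esub>) = \<lbrace>h a, h b\<rbrace>\<^bsub>B\<^esub>)}"

text \<open>The target of a Poisson morphism is only required to be an algebra with a bracket operation:
  the bracket of two functions of finite differentiability class may leave that class. For elements
  of the image the definition forces the bracket to lie in the target again.\<close>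

definition poisson_morphism ::
  "('r, 's) ring_scheme \<Rightarrow> ('r, 'a, 'm) poisson_scheme \<Rightarrow> ('r, 'b, 'n) poisson_scheme \<Rightarrow> ('a \<Rightarrow> 'b) \<Rightarrow> bool"
  where "poisson_morphism R A B h \<longleftrightarrow>
    poisson_algebra R A \<and> algebra R B \<and> h \<in> poisson_hom R A B"

definition poisson_isomorphism ::
  "('r, 's) ring_scheme \<Rightarrow> ('r, 'a, 'm) poisson_scheme \<Rightarrow> ('r, 'b, 'n) poisson_scheme \<Rightarrow> ('a \<Rightarrow> 'b) \<Rightarrow> bool"
  where "poisson_isomorphism R A B h \<longleftrightarrow>
    poisson_algebra R A \<and> poisson_algebra R B \<and>
    h \<in> poisson_hom R A B \<and> bij_betw h (carrier A) (carrier B)"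

text \<open>Used with factor 2: with \<open>{p, q} = q / (2\<pi>)\<close> the components of the map to the surface satisfy
  \<open>{x, y} = - k z^(2k - 1)\<close>, \<open>{y, z} = x\<close>, \<open>{z, x} = y\<close>, which is half of the bracket that
  \<open>F = x^2 + y^2 - z^(2k)\<close> determines on three-space.\<close>

definition rescale_bracket :: "'r \<Rightarrow> ('r, 'a) poisson \<Rightarrow> ('r, 'a) poisson"
  where "rescale_bracket c A = A\<lparr>pbracket := \<lambda>a b. c \<odot>\<^bsub>A\<^esub> \<lbrace>a, b\<rbrace>\<^bsub>A\<^esub>\<rparr>"

definition real_field :: "real ring"
  where "real_field = \<lparr>carrier = UNIV, mult = (*), one = 1, zero = 0, add = (+)\<rparr>"

definition function_algebra ::
  "('v \<Rightarrow> real) set \<Rightarrow> (('v \<Rightarrow> real) \<Rightarrow> ('v \<Rightarrow> real) \<Rightarrow> 'v \<Rightarrow> real) \<Rightarrow> (real, 'v \<Rightarrow> real) poisson"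
  where "function_algebra C br =
    \<lparr>carrier = C, mult = \<lambda>f g v. f v * g v, one = \<lambda>v. 1, zero = \<lambda>v. 0, add = \<lambda>f g v. f v + g v,
     smult = \<lambda>c f v. c * f v, pbracket = br\<rparr>"

inductive_set generated_algebra :: "('v \<Rightarrow> real) set \<Rightarrow> ('v \<Rightarrow> real) set" for S
  where
    const: "(\<lambda>v. c) \<in> generated_algebra S"
  | gen: "f \<in> S \<Longrightarrow> f \<in> generated_algebra S"
  | add: "\<lbrakk>f \<in> generated_algebra S; g \<in> generated_algebra S\<rbrakk> \<Longrightarrow> (\<lambda>v. f v + g v) \<in> generated_algebra S"
  | mult: "\<lbrakk>f \<in> generated_algebra S; g \<in> generated_algebra S\<rbrakk> \<Longrightarrow> (\<lambda>v. f v * g v) \<in> generated_algebra S"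


section \<open>Differentiability classes\<close>

text \<open>Frechet differentiability of order \<open>n\<close> on an open set; the derivatives of top order are not
  required to be continuous.\<close>

primrec times_differentiable_on :: "nat \<Rightarrow> 'a::euclidean_space set \<Rightarrow> ('a \<Rightarrow> real) \<Rightarrow> bool"
  where
    "times_differentiable_on 0 S f \<longleftrightarrow> True"
  | "times_differentiable_on (Suc n) S f \<longleftrightarrow>
      (\<forall>v\<in>S. f differentiable at v) \<and>
      (\<forall>e. times_differentiable_on n S (\<lambda>v. frechet_derivative f (at v) e))"

definition smooth_on :: "'a::euclidean_space set \<Rightarrow> ('a \<Rightarrow> real) \<Rightarrow> bool"
  where "smooth_on S f \<longleftrightarrow> (\<forall>n. times_differentiable_on n S f)"


section \<open>The quotient of the plane\<close>

type_synonym plane = "real \<times> real"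
type_synonym space = "real \<times> real \<times> real"

definition shear :: "int \<Rightarrow> plane \<Rightarrow> plane"
  where "shear n = (\<lambda>(p, q). (p + of_int n * q, q))"

definition plane_rel :: "plane \<Rightarrow> plane \<Rightarrow> bool"
  where "plane_rel u v \<longleftrightarrow> (\<exists>n. v = shear n u) \<or> (snd u = 0 \<and> snd v = 0)"

lemma equivp_plane_rel: "equivp plane_rel"
proof (rule equivpI)
  show "reflp plane_rel"
    by (rule reflpI) (auto simp: plane_rel_def shear_def intro!: exI[of _ 0])
  show "symp plane_rel"
  proof (rule sympI)
    fix u v assume "plane_rel u v"
    then show "plane_rel v u"
    proof (unfold plane_rel_def, elim disjE exE)
      fix n assume "v = shear n u"
      then have "u = shear (- n) v" by (auto simp: shear_def split: prod.splits)
      then show "(\<exists>n. u = shear n v) \<or> snd v = 0 \<and> snd u = 0" by blast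
    qed auto
  qed
  show "transp plane_rel"
  proof (rule transpI)
    fix u v w assume uv: "plane_rel u v" and vw: "plane_rel v w"
    show "plane_rel u w"
    proof (cases "snd u = 0")
      case True
      then show ?thesis using uv vw by (auto simp: plane_rel_def shear_def case_prod_beta)
    next
      case False
      with uv obtain m where m: "v = shear m u" by (auto simp: plane_rel_def)
      with False have "snd v \<noteq> 0" by (auto simp: shear_def split: prod.splits)
      with vw obtain n where n: "w = shear n v" by (auto simp: plane_rel_def)
      have "w = shear (m + n) u"
        using m n by (auto simp: shear_def algebra_simps split: prod.splits)
      then show ?thesis by (auto simp: plane_rel_def)
    qed
  qed
qed

quotient_type plane_mod_G = plane / plane_rel
  by (rule equivp_plane_rel)

text \<open>A function on the quotient is represented by its composition with the projection, that is, by
  a function on the plane that is constant on the classes. For continuous functions this is the same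
  as invariance under all \<^const>\<open>shear\<close>s.\<close>

definition invariant :: "(plane \<Rightarrow> real) \<Rightarrow> bool"
  where "invariant f \<longleftrightarrow> (\<forall>u v. plane_rel u v \<longrightarrow> f u = f v)"

text \<open>The bracket with \<open>{p, q} = q / (2\<pi>)\<close>.\<close>

definition plane_bracket :: "(plane \<Rightarrow> real) \<Rightarrow> (plane \<Rightarrow> real) \<Rightarrow> plane \<Rightarrow> real"
  where "plane_bracket f g = (\<lambda>(p, q). q / (2 * pi) *
    (frechet_derivative f (at (p, q)) (1, 0) * frechet_derivative g (at (p, q)) (0, 1) -
     frechet_derivative f (at (p, q)) (0, 1) * frechet_derivative g (at (p, q)) (1, 0)))"

definition C_quotient :: "nat \<Rightarrow> (real, plane \<Rightarrow> real) poisson"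
  where "C_quotient r = function_algebra
    {f. invariant f \<and> times_differentiable_on r UNIV f \<and> smooth_on {v. snd v \<noteq> 0} f} plane_bracket"


section \<open>The map to the surface\<close>

definition phi :: "nat \<Rightarrow> plane \<Rightarrow> space"
  where "phi k = (\<lambda>(p, q). if q = 0 then (0, 0, 0)
    else (q ^ k * cos (2 * pi * p / q), q ^ k * sin (2 * pi * p / q), q))"

definition A_surface :: "nat \<Rightarrow> space set"
  where "A_surface k = {(x, y, z). x\<^sup>2 + y\<^sup>2 = z ^ (2 * k)}"

lift_definition phi_quot :: "nat \<Rightarrow> plane_mod_G \<Rightarrow> space" is phi
proof -
  fix k u v assume "plane_rel u v"
  then show "phi k u = phi k v"
  proof (unfold plane_rel_def, elim disjE exE)
    fix n assume v: "v = shear n u"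
    obtain p q where u: "u = (p, q)" by (cases u)
    show ?thesis
    proof (cases "q = 0")
      case False
      then have "2 * pi * (p + of_int n * q) / q = 2 * pi * p / q + 2 * pi * of_int n"
        by (simp add: field_simps)
      then show ?thesis
        using False by (simp add: u v phi_def shear_def cos_add sin_add)
    qed (simp add: u v phi_def shear_def)
  next
    assume "snd u = 0 \<and> snd v = 0"
    then show ?thesis by (auto simp: phi_def split: prod.splits)
  qed
qed

lemma phi_quot_in_A_surface:
  assumes "k > 0"
  shows "phi_quot k c \<in> A_surface k"
proof (transfer fixing: k)
  fix u :: plane
  obtain p q where u: "u = (p, q)" by (cases u)
  have "(q ^ k * cos t)\<^sup>2 + (q ^ k * sin t)\<^sup>2 = q ^ (2 * k)" for t
  proof -
    have "(q ^ k * cos t)\<^sup>2 + (q ^ k * sin t)\<^sup>2 = (q ^ k)\<^sup>2 * ((cos t)\<^sup>2 + (sin t)\<^sup>2)"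
      by (simp only: power_mult_distrib distrib_left)
    then show ?thesis by (simp add: power_mult mult.commute flip: power_mult)
  qed
  then show "phi k u \<in> A_surface k"
    using assms by (auto simp: u phi_def A_surface_def)
qed

definition pullback :: "nat \<Rightarrow> (space \<Rightarrow> real) \<Rightarrow> plane \<Rightarrow> real"
  where "pullback k f = f \<circ> phi_quot k \<circ> abs_plane_mod_G"

definition generated_A :: "nat \<Rightarrow> (real, plane \<Rightarrow> real) poisson"
  where "generated_A k = function_algebra
    (generated_algebra
      {\<lambda>v. fst (phi k v), \<lambda>v. fst (snd (phi k v)), \<lambda>v. snd (snd (phi k v))}) plane_bracket"


section \<open>The Poisson structure on three-space\<close>

definition F_fun :: "nat \<Rightarrow> space \<Rightarrow> real"
  where "F_fun k = (\<lambda>(x, y, z). x\<^sup>2 + y\<^sup>2 - z ^ (2 * k))"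

definition dx :: "(space \<Rightarrow> real) \<Rightarrow> space \<Rightarrow> real"
  where "dx f v = frechet_derivative f (at v) (1, 0, 0)"

definition dy :: "(space \<Rightarrow> real) \<Rightarrow> space \<Rightarrow> real"
  where "dy f v = frechet_derivative f (at v) (0, 1, 0)"

definition dz :: "(space \<Rightarrow> real) \<Rightarrow> space \<Rightarrow> real"
  where "dz f v = frechet_derivative f (at v) (0, 0, 1)"

definition space_bracket :: "nat \<Rightarrow> (space \<Rightarrow> real) \<Rightarrow> (space \<Rightarrow> real) \<Rightarrow> space \<Rightarrow> real"
  where "space_bracket k f g v =
    dz (F_fun k) v * (dx f v * dy g v - dy f v * dx g v) +
    dx (F_fun k) v * (dy f v * dz g v - dz f v * dy g v) +
    dy (F_fun k) v * (dz f v * dx g v - dx f v * dz g v)"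

definition C_infinity_space :: "nat \<Rightarrow> (real, space \<Rightarrow> real) poisson"
  where "C_infinity_space k = function_algebra {f. smooth_on UNIV f} (space_bracket k)"


section \<open>Polynomial functions on the surface\<close>

text \<open>\<open>\<real>[x, y, z]\<close> is the iterated polynomial ring \<open>\<real>[z][y][x]\<close>, with \<open>x\<close> the outermost variable.\<close>

type_synonym poly3 = "real poly poly poly"

definition X :: poly3 where "X = [:0, 1:]"
definition Y :: poly3 where "Y = [:[:0, 1:]:]"
definition Z :: poly3 where "Z = [:[:[:0, 1:]:]:]"
definition Const :: "real \<Rightarrow> poly3" where "Const c = [:[:[:c:]:]:]"

definition poly_fun :: "poly3 \<Rightarrow> space \<Rightarrow> real"
  where "poly_fun P = (\<lambda>(x, y, z). poly (poly (poly P [:[:x:]:]) [:y:]) z)"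

definition pdx :: "poly3 \<Rightarrow> poly3" where "pdx P = pderiv P"
definition pdy :: "poly3 \<Rightarrow> poly3" where "pdy P = map_poly pderiv P"
definition pdz :: "poly3 \<Rightarrow> poly3" where "pdz P = map_poly (map_poly pderiv) P"

definition F_poly :: "nat \<Rightarrow> poly3"
  where "F_poly k = X\<^sup>2 + Y\<^sup>2 - Z ^ (2 * k)"

definition poly_bracket :: "nat \<Rightarrow> poly3 \<Rightarrow> poly3 \<Rightarrow> poly3"
  where "poly_bracket k P Q =
    pdz (F_poly k) * (pdx P * pdy Q - pdy P * pdx Q) +
    pdx (F_poly k) * (pdy P * pdz Q - pdz P * pdy Q) +
    pdy (F_poly k) * (pdz P * pdx Q - pdx P * pdz Q)"

definition poly3_ring :: "poly3 ring"
  where "poly3_ring = \<lparr>carrier = UNIV, mult = (*), one = 1, zero = 0, add = (+)\<rparr>"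

definition F_ideal :: "nat \<Rightarrow> poly3 set"
  where "F_ideal k = PIdl\<^bsub>poly3_ring\<^esub> F_poly k"

definition poly_class :: "nat \<Rightarrow> poly3 \<Rightarrow> poly3 set"
  where "poly_class k P = F_ideal k +>\<^bsub>poly3_ring\<^esub> P"

text \<open>Scalar multiplication and bracket on cosets are defined by the same union construction as the
  multiplication of the library's quotient ring.\<close>

definition polynomial_functions :: "nat \<Rightarrow> (real, poly3 set) poisson"
  where "polynomial_functions k = (let Q = poly3_ring Quot F_ideal k in
    \<lparr>carrier = carrier Q, mult = mult Q, one = one Q, zero = zero Q, add = add Q,
     smult = \<lambda>c A. \<Union>P\<in>A. poly_class k (Const c * P),
     pbracket = \<lambda>A B. \<Union>P\<in>A. \<Union>Q\<in>B. poly_class k (poly_bracket k P Q)\<rparr>)"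

definition phi_quot_star :: "nat \<Rightarrow> poly3 set \<Rightarrow> plane \<Rightarrow> real"
  where "phi_quot_star k A = the_elem ((\<lambda>P. pullback k (poly_fun P)) ` A)"

end

theory Submission
  imports Defs
begin

text \<open>The pullback of a smooth function is differentiable \<open>\<lfloor>k/2\<rfloor>\<close> times because each derivative of
  \<open>p ^ j * q ^ m * cos (2 * pi * p / q + a)\<close> is a combination of such functions that has lost at most
  two powers of \<open>q\<close>. Where \<open>q \<noteq> 0\<close> the brackets correspond by the chain rule; on the axis both vanish.
  The Jacobi identity on three-space is the symmetry of second derivatives. For the isomorphism,
  divide a polynomial by \<open>F\<close>, which is monic in \<open>X\<close>, with remainder \<open>a + b * X\<close>: if it vanishes on
  the surface, then so do both \<open>a + b * x\<close> and \<open>a - b * x\<close> by reflection in \<open>x\<close>, and \<open>a\<close>, \<open>b\<close> vanish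
  on infinitely many \<open>y\<close> for each \<open>z \<noteq> 0\<close>. Hence the cosets of the ideal are exactly the fibres of the
  pullback, and the Poisson axioms are carried along surjections that respect the operations.\<close>

section \<open>Differentiability classes and mixed derivatives\<close>

lemma has_derivative_imp_frechet:
  "(f has_derivative D) (at v) \<Longrightarrow> frechet_derivative f (at v) = D"
  by (metis frechet_derivative_at)

lemma differentiable_imp_has_frechet:
  "f differentiable at v \<Longrightarrow> (f has_derivative frechet_derivative f (at v)) (at v)"
  using frechet_derivative_works by blast

text \<open>On an open set a derivative depends only on nearby values, so agreement of two functions
  on \<open>S\<close> is inherited by their derivatives on \<open>S\<close>.\<close>

lemma times_differentiable_on_cong:
  assumes "open S" "\<And>v. v \<in> S \<Longrightarrow> f v = g v"
  shows "times_differentiable_on n S f \<longleftrightarrow> times_differentiable_on n S g"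
  using assms(2)
proof (induction n arbitrary: f g)
  case (Suc n)
  have eq: "frechet_derivative f (at v) = frechet_derivative g (at v)"
      "f differentiable at v \<longleftrightarrow> g differentiable at v" if "v \<in> S" for v
  proof -
    \<comment> \<open>\<open>frechet_derivative\<close> is a choice over all \<open>D\<close> with
      this property. Equivalent properties give the same choice, so the two agree even at points
      without a derivative.\<close>
    have "(f has_derivative D) (at v) \<longleftrightarrow> (g has_derivative D) (at v)" for D
      using has_derivative_transform_within_open[OF _ assms(1) that] Suc.prems by metis
    then show "frechet_derivative f (at v) = frechet_derivative g (at v)"
      "f differentiable at v \<longleftrightarrow> g differentiable at v"
      by (simp_all add: frechet_derivative_def differentiable_def)
  qed
  show ?case
    using Suc.IH[of "\<lambda>v. frechet_derivative f (at v) e" "\<lambda>v. frechet_derivative g (at v) e" for e] eq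
    by auto
qed simp

text \<open>Allows an explicit derivative \<open>D\<close> in place of the chosen
  \<open>frechet_derivative\<close>; the two agree on \<open>S\<close> because derivatives are
  unique.\<close>

lemma times_differentiable_on_SucI:
  assumes "open S" "\<And>v. v \<in> S \<Longrightarrow> (f has_derivative D v) (at v)"
    and "\<And>e. times_differentiable_on n S (\<lambda>v. D v e)"
  shows "times_differentiable_on (Suc n) S f"
proof -
  have "times_differentiable_on n S (\<lambda>v. frechet_derivative f (at v) e) \<longleftrightarrow>
      times_differentiable_on n S (\<lambda>v. D v e)" for e
    using assms(2) by (intro times_differentiable_on_cong assms(1)) (metis has_derivative_imp_frechet)
  then show ?thesis
    using assms by (auto simp: differentiable_def)
qed

lemma times_differentiable_on_Suc_imp:
  "times_differentiable_on (Suc n) S f \<Longrightarrow> times_differentiable_on n S f"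
  by (induction n arbitrary: f) auto

lemma times_differentiable_on_has_derivative:
  "times_differentiable_on (Suc n) S f \<Longrightarrow> v \<in> S \<Longrightarrow>
    (f has_derivative frechet_derivative f (at v)) (at v)"
  by (simp add: differentiable_imp_has_frechet)

lemma times_differentiable_on_const: "times_differentiable_on n S (\<lambda>v. c)"
  by (induction n arbitrary: c) auto

lemma times_differentiable_on_linear:
  assumes "bounded_linear f" "open S"
  shows "times_differentiable_on n S f"
  using times_differentiable_on_SucI[OF assms(2) bounded_linear.has_derivative[OF assms(1) has_derivative_ident]]
    times_differentiable_on_const by (cases n) auto

lemma times_differentiable_on_add:
  assumes "open S" "times_differentiable_on n S f" "times_differentiable_on n S g"
  shows "times_differentiable_on n S (\<lambda>v. f v + g v)"
  using assms(2,3)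
proof (induction n arbitrary: f g)
  case (Suc n)
  show ?case
    by (rule times_differentiable_on_SucI[OF assms(1) has_derivative_add[OF
          times_differentiable_on_has_derivative[OF Suc.prems(1)]
          times_differentiable_on_has_derivative[OF Suc.prems(2)]]])
      (use Suc in auto)
qed simp

lemma times_differentiable_on_mult:
  assumes "open S" "times_differentiable_on n S f" "times_differentiable_on n S g"
  shows "times_differentiable_on n S (\<lambda>v. f v * g v)"
  using assms(2,3)
proof (induction n arbitrary: f g)
  case (Suc n)
  show ?case
    by (rule times_differentiable_on_SucI[OF assms(1) has_derivative_mult[OF
          times_differentiable_on_has_derivative[OF Suc.prems(1)]
          times_differentiable_on_has_derivative[OF Suc.prems(2)]]])
      \<comment> \<open>The product rule also contains \<open>f\<close> and \<open>g\<close>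
        themselves, which are needed at the lower order \<open>n\<close>.\<close>
      (use Suc Suc.prems[THEN times_differentiable_on_Suc_imp]
        in \<open>auto intro!: times_differentiable_on_add[OF assms(1)]\<close>)
qed simp

lemma times_differentiable_on_sum:
  assumes "open S" "\<And>i. i \<in> I \<Longrightarrow> times_differentiable_on n S (f i)"
  shows "times_differentiable_on n S (\<lambda>v. \<Sum>i\<in>I. f i v)"
  using assms(2)
  by (induction I rule: infinite_finite_induct)
     (auto intro!: times_differentiable_on_const times_differentiable_on_add[OF assms(1)])

lemma frechet_derivative_Basis_sum:
  fixes f :: "'a::euclidean_space \<Rightarrow> real"
  assumes "f differentiable at v"
  shows "frechet_derivative f (at v) w = (\<Sum>b\<in>Basis. (w \<bullet> b) * frechet_derivative f (at v) b)"
proof -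
  have L: "linear (frechet_derivative f (at v))"
    using assms by (rule linear_frechet_derivative)
  show ?thesis
    by (subst euclidean_representation[of w, symmetric])
       (simp add: linear_sum[OF L] linear_scale[OF L])
qed

text \<open>By the chain rule the derivative of \<open>f\<close> is taken in the direction
  \<open>D v e\<close>, which moves with \<open>v\<close>, whereas the class only controls fixed
  directions. Expanding in \<open>Basis\<close> leaves products of derivatives of the components of
  \<open>g\<close> with partial derivatives of \<open>f\<close> composed with the same
  \<open>g\<close>, to which the induction hypothesis applies.\<close>

lemma times_differentiable_on_compose:
  fixes f :: "'b::euclidean_space \<Rightarrow> real" and g :: "'a::euclidean_space \<Rightarrow> 'b"
  assumes "open S" "times_differentiable_on n UNIV f"
    and "\<And>b. b \<in> Basis \<Longrightarrow> times_differentiable_on n S (\<lambda>v. g v \<bullet> b)"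
  shows "times_differentiable_on n S (\<lambda>v. f (g v))"
  using assms(2,3)
proof (induction n arbitrary: f)
  case (Suc n)
  define D where "D v e = (\<Sum>b\<in>Basis. frechet_derivative (\<lambda>v. g v \<bullet> b) (at v) e *\<^sub>R b)" for v e
  have D_inner: "D v e \<bullet> b = frechet_derivative (\<lambda>v. g v \<bullet> b) (at v) e" if "b \<in> Basis" for v e b
    using that by (simp add: D_def inner_sum_left inner_Basis if_distrib cong: if_cong)
  have g: "(g has_derivative D v) (at v)" if "v \<in> S" for v
    unfolding has_derivative_componentwise_within[of g]
    using Suc.prems(2) that by (auto simp: D_inner intro!: differentiable_imp_has_frechet)
  have f: "(f has_derivative frechet_derivative f (at w)) (at w)" for w
    using Suc.prems(1) by (auto intro!: differentiable_imp_has_frechet)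
  have fg: "((\<lambda>v. f (g v)) has_derivative (\<lambda>e. frechet_derivative f (at (g v)) (D v e))) (at v)"
    if "v \<in> S" for v
    using has_derivative_compose[OF g[OF that] f] .
  show ?case
  proof (rule times_differentiable_on_SucI[OF assms(1) fg])
    fix e
    have "frechet_derivative f (at (g v)) (D v e) =
        (\<Sum>b\<in>Basis. frechet_derivative (\<lambda>v. g v \<bullet> b) (at v) e * frechet_derivative f (at (g v)) b)" for v
      using Suc.prems(1) by (subst frechet_derivative_Basis_sum) (auto simp: D_inner)
    moreover have "times_differentiable_on n S
       (\<lambda>v. \<Sum>b\<in>Basis. frechet_derivative (\<lambda>v. g v \<bullet> b) (at v) e * frechet_derivative f (at (g v)) b)"
    proof (intro times_differentiable_on_sum times_differentiable_on_mult assms(1))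
      fix b :: 'b assume b: "b \<in> Basis"
      show "times_differentiable_on n S (\<lambda>v. frechet_derivative (\<lambda>v. g v \<bullet> b) (at v) e)"
        using Suc.prems(2)[OF b] by simp
      show "times_differentiable_on n S (\<lambda>v. frechet_derivative f (at (g v)) b)"
        using Suc.prems(1)
        by (intro Suc.IH[where f="\<lambda>w. frechet_derivative f (at w) b"] times_differentiable_on_Suc_imp[OF Suc.prems(2)]) auto
    qed
    ultimately show "times_differentiable_on n S (\<lambda>v. frechet_derivative f (at (g v)) (D v e))"
      by simp
  qed
qed simp

lemma smooth_on_imp_differentiable: "smooth_on S f \<Longrightarrow> v \<in> S \<Longrightarrow> f differentiable at v"
  unfolding smooth_on_def using times_differentiable_on.simps(2)[of 0] by blast

lemma smooth_on_frechet_derivative: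
  "smooth_on S f \<Longrightarrow> smooth_on S (\<lambda>v. frechet_derivative f (at v) e)"
  unfolding smooth_on_def using times_differentiable_on.simps(2) by blast

section \<open>Symmetry of second derivatives\<close>

lemma directional_mean_value:
  fixes f :: "'a::euclidean_space \<Rightarrow> real"
  assumes "\<And>v. f differentiable at v" "h > 0"
  obtains s where "0 < s" "s < h" "f (v + h *\<^sub>R a) - f v = h * frechet_derivative f (at (v + s *\<^sub>R a)) a"
proof -
  have D: "((\<lambda>s. f (v + s *\<^sub>R a)) has_real_derivative frechet_derivative f (at (v + s *\<^sub>R a)) a) (at s)" for s
  proof -
    have f: "(f has_derivative frechet_derivative f (at w)) (at w)" for w
      using assms by (simp add: differentiable_imp_has_frechet)
    have L: "linear (frechet_derivative f (at w))" for w
      using assms by (simp add: linear_frechet_derivative)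
    have "((\<lambda>s. v + s *\<^sub>R a) has_derivative (\<lambda>t. t *\<^sub>R a)) (at s)"
      by (auto intro!: derivative_eq_intros)
    from has_derivative_compose[OF this f] show ?thesis
      by (simp add: has_field_derivative_def linear_scale[OF L] mult_commute_abs)
  qed
  show ?thesis
    using MVT2[OF assms(2) D] that by auto
qed

text \<open>The mean value theorem is used twice: along \<open>a\<close> for the increment of
  \<open>f\<close> by \<open>h *\<^sub>R b\<close>, then along \<open>b\<close> for the derivative
  of \<open>f\<close> in direction \<open>a\<close>.\<close>

lemma second_difference:
  fixes f :: "'a::euclidean_space \<Rightarrow> real"
  assumes f: "\<And>v. f differentiable at v"
    and fa: "\<And>v. (\<lambda>w. frechet_derivative f (at w) a) differentiable at v" and "h > 0"
  obtains s t where "0 < s" "s < h" "0 < t" "t < h"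
    "f (v + h *\<^sub>R a + h *\<^sub>R b) - f (v + h *\<^sub>R a) - f (v + h *\<^sub>R b) + f v =
      h * h * frechet_derivative (\<lambda>w. frechet_derivative f (at w) a) (at (v + s *\<^sub>R a + t *\<^sub>R b)) b"
proof -
  have f': "(f has_derivative frechet_derivative f (at w)) (at w)" for w
    using f by (simp add: differentiable_imp_has_frechet)
  have sh: "((\<lambda>w. w + h *\<^sub>R b) has_derivative (\<lambda>e. e)) (at w)" for w
    by (auto intro!: derivative_eq_intros)
  have g: "((\<lambda>w. f (w + h *\<^sub>R b) - f w) has_derivative
      (\<lambda>e. frechet_derivative f (at (w + h *\<^sub>R b)) e - frechet_derivative f (at w) e)) (at w)" for w
    by (intro has_derivative_diff f' has_derivative_compose[OF sh f'])
  obtain s where s: "0 < s" "s < h"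
    "f (v + h *\<^sub>R a + h *\<^sub>R b) - f (v + h *\<^sub>R a) - (f (v + h *\<^sub>R b) - f v) =
     h * (frechet_derivative f (at (v + s *\<^sub>R a + h *\<^sub>R b)) a - frechet_derivative f (at (v + s *\<^sub>R a)) a)"
    using directional_mean_value[of "\<lambda>w. f (w + h *\<^sub>R b) - f w" h v a] g \<open>h > 0\<close>
    by (auto simp: has_derivative_imp_frechet[OF g] differentiable_def algebra_simps)
  obtain t where "0 < t" "t < h"
    "frechet_derivative f (at (v + s *\<^sub>R a + h *\<^sub>R b)) a - frechet_derivative f (at (v + s *\<^sub>R a)) a =
      h * frechet_derivative (\<lambda>w. frechet_derivative f (at w) a) (at (v + s *\<^sub>R a + t *\<^sub>R b)) b"
    using directional_mean_value[OF fa \<open>h > 0\<close>, where v="v + s *\<^sub>R a" and a=b] by blast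
  with s show ?thesis by (intro that[of s t]) (auto simp: algebra_simps)
qed

text \<open>Both iterated derivatives are limits of the same second difference quotient.\<close>

lemma mixed_derivatives_commute:
  fixes f :: "'a::euclidean_space \<Rightarrow> real"
  assumes "smooth_on UNIV f"
  shows "frechet_derivative (\<lambda>w. frechet_derivative f (at w) a) (at v) b =
    frechet_derivative (\<lambda>w. frechet_derivative f (at w) b) (at v) a"
proof -
  define Q where "Q h = (f (v + h *\<^sub>R a + h *\<^sub>R b) - f (v + h *\<^sub>R a) - f (v + h *\<^sub>R b) + f v) / (h * h)" for h
  \<comment> \<open>\<open>Q\<close> is symmetric in \<open>a\<close> and \<open>b\<close>, so one
    argument gives the limit for both orders of differentiation.\<close>
  have lim: "((\<lambda>n. Q (1 / real (Suc n))) \<longlonglongrightarrow>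
      frechet_derivative (\<lambda>w. frechet_derivative f (at w) c) (at v) d)"
    if cd: "(c, d) = (a, b) \<or> (c, d) = (b, a)" for c d
  proof -
    let ?D = "\<lambda>v. frechet_derivative (\<lambda>w. frechet_derivative f (at w) c) (at v) d"
    have "\<exists>s t. 0 < s \<and> s < h \<and> 0 < t \<and> t < h \<and> Q h = ?D (v + s *\<^sub>R c + t *\<^sub>R d)" if "h > 0" for h
    proof -
      have Q: "Q h * (h * h) = f (v + h *\<^sub>R c + h *\<^sub>R d) - f (v + h *\<^sub>R c) - f (v + h *\<^sub>R d) + f v"
      proof -
        have 1: "Q h * (h * h) = f (v + h *\<^sub>R a + h *\<^sub>R b) - f (v + h *\<^sub>R a) - f (v + h *\<^sub>R b) + f v"
          using \<open>h > 0\<close> by (simp add: Q_def)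
        have swap: "v + h *\<^sub>R a + h *\<^sub>R b = v + h *\<^sub>R b + h *\<^sub>R a" by simp
        from 1 have 2: "Q h * (h * h) = f (v + h *\<^sub>R b + h *\<^sub>R a) - f (v + h *\<^sub>R b) - f (v + h *\<^sub>R a) + f v"
          unfolding swap by linarith
        from cd 1 2 show ?thesis by (metis Pair_inject)
      qed
      obtain s t where "0 < s" "s < h" "0 < t" "t < h" "Q h * (h * h) = h * h * ?D (v + s *\<^sub>R c + t *\<^sub>R d)"
        using second_difference[OF smooth_on_imp_differentiable[OF assms UNIV_I]
            smooth_on_imp_differentiable[OF smooth_on_frechet_derivative[OF assms] UNIV_I] \<open>h > 0\<close>,
            of v c d] unfolding Q by blast
      then show ?thesis using \<open>h > 0\<close> by auto
    qed
    then have "\<exists>s t. 0 < s \<and> s < 1 / real (Suc n) \<and> 0 < t \<and> t < 1 / real (Suc n) \<and>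
        Q (1 / real (Suc n)) = ?D (v + s *\<^sub>R c + t *\<^sub>R d)" for n by simp
    then obtain s t where st: "\<And>n. 0 < s n" "\<And>n. s n < 1 / real (Suc n)" "\<And>n. 0 < t n"
        "\<And>n. t n < 1 / real (Suc n)" "\<And>n. Q (1 / real (Suc n)) = ?D (v + s n *\<^sub>R c + t n *\<^sub>R d)"
      by metis
    have z: "(\<lambda>n. 1 / real (Suc n)) \<longlonglongrightarrow> 0"
      using LIMSEQ_inverse_real_of_nat by (simp add: inverse_eq_divide)
    have "s \<longlonglongrightarrow> 0" "t \<longlonglongrightarrow> 0"
      by (rule tendsto_sandwich[OF _ _ tendsto_const z]; intro always_eventually allI less_imp_le st)+
    then have "(\<lambda>n. v + s n *\<^sub>R c + t n *\<^sub>R d) \<longlonglongrightarrow> v + 0 *\<^sub>R c + 0 *\<^sub>R d"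
      by (intro tendsto_intros)
    \<comment> \<open>The second derivative is continuous because it is itself
      differentiable.\<close>
    moreover have "isCont ?D v"
      using smooth_on_imp_differentiable[OF smooth_on_frechet_derivative[OF
            smooth_on_frechet_derivative[OF assms]] UNIV_I]
      by (rule differentiable_imp_continuous_within)
    ultimately show ?thesis
      unfolding st(5) by (intro isCont_tendsto_compose[where g="?D"]) auto
  qed
  show ?thesis
    by (rule LIMSEQ_unique[OF lim lim]) simp_all
qed

section \<open>The pullback along the map to the surface\<close>

text \<open>A family closed under differentiation: the phase \<open>a\<close> covers sine as well as
  cosine, the factor \<open>p ^ j\<close> absorbs the inner derivative of \<open>p / q\<close>, and
  an integer exponent can drop below zero away from the axis. The value 0 on the axis matches
  \<open>phi\<close>.\<close>

definition osc :: "nat \<Rightarrow> int \<Rightarrow> real \<Rightarrow> plane \<Rightarrow> real"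
  where "osc j m a = (\<lambda>(p, q). if q = 0 then 0 else p ^ j * q powi m * cos (2 * pi * p / q + a))"

text \<open>Minus sine is written as cosine with phase advanced by \<open>pi / 2\<close>, so only
  \<open>osc\<close> occurs. For \<open>j = 0\<close> the truncated \<open>j - 1\<close> is
  harmless, as its term carries the factor \<open>real j\<close>.\<close>

definition osc_deriv :: "nat \<Rightarrow> int \<Rightarrow> real \<Rightarrow> plane \<Rightarrow> plane \<Rightarrow> real"
  where "osc_deriv j m a v e =
    fst e * (real j * osc (j - 1) m a v + 2 * pi * osc j (m - 1) (a + pi / 2) v) +
    snd e * (of_int m * osc j (m - 1) a v - 2 * pi * osc (j + 1) (m - 2) (a + pi / 2) v)"

lemma cos_add_half_pi: "cos (t + pi / 2) = - sin t"
  by (simp add: cos_add)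

lemma open_off_axis: "open {v::plane. snd v \<noteq> 0}"
  by (intro open_Collect_neq continuous_intros)

lemma osc_has_derivative_off_axis:
  assumes "snd v \<noteq> 0"
  shows "(osc j m a has_derivative osc_deriv j m a v) (at v)"
proof -
  obtain p q where v: "v = (p, q)" "q \<noteq> 0" using assms by (cases v) auto
  define f where "f = (\<lambda>w::plane. fst w ^ j * snd w powi m * cos (2 * pi * fst w / snd w + a))"
  have 1: "((\<lambda>w::plane. fst w ^ j) has_derivative (\<lambda>e. real j * p ^ (j - 1) * fst e)) (at v)"
    by (auto intro!: derivative_eq_intros simp: v)
  have 2: "((\<lambda>w::plane. snd w powi m) has_derivative (\<lambda>e. of_int m * q powi (m - 1) * snd e)) (at v)"
    by (auto intro!: derivative_eq_intros simp: v fun_eq_iff)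
  have 3: "((\<lambda>w::plane. cos (2 * pi * fst w / snd w + a)) has_derivative
      (\<lambda>e. - sin (2 * pi * p / q + a) * (2 * pi * (fst e / q - p * snd e / (q * q))))) (at v)"
    by (auto intro!: derivative_eq_intros simp: v fun_eq_iff diff_divide_distrib algebra_simps)
  have cs: "cos (2 * pi * p / q + (a + pi / 2)) = - sin (2 * pi * p / q + a)"
    using cos_add_half_pi[of "2 * pi * p / q + a"] by (simp add: add.assoc)
  have [simp]: "q powi (m - 1) = q powi m / q" "q powi (m - 2) = q powi m / (q * q)"
    using v(2) by (simp_all add: power_int_diff power2_eq_square)
  have f: "(f has_derivative osc_deriv j m a v) (at v)"
    unfolding f_def
    by (rule has_derivative_eq_rhs[OF has_derivative_mult[OF has_derivative_mult[OF 1 2] 3]])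
       (simp add: fun_eq_iff osc_deriv_def osc_def v cs, simp add: algebra_simps)
  show ?thesis
    by (rule has_derivative_transform_within_open[OF f open_off_axis])
       (use assms in \<open>auto simp: f_def osc_def case_prod_beta\<close>)
qed

text \<open>Near the axis the function is at most \<open>\<bar>p\<bar> ^ j * q\<^sup>2\<close>.
  Dividing by the distance, which is at least the absolute value of q, leaves a bound that tends to
  0. So the derivative is 0, which is also what \<open>osc_deriv\<close> gives there by its values
  on the axis.\<close>

lemma osc_has_derivative_on_axis:
  assumes "snd v = 0" "m \<ge> 2"
  shows "(osc j m a has_derivative osc_deriv j m a v) (at v)"
proof -
  obtain p where v: "v = (p, 0)" using assms by (cases v) auto
  have D: "osc_deriv j m a v = (\<lambda>e. 0)"
    by (rule ext) (simp add: osc_deriv_def osc_def v)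
  show ?thesis
    unfolding D
  \<comment> \<open>Within radius 1 the absolute value of q is below 1, so its power
    \<open>m\<close> is bounded by its square.\<close>
  proof (rule has_derivativeI_sandwich[of 1])
    fix w :: plane assume w: "w \<noteq> v" "dist w v < 1"
    have "\<bar>snd w\<bar> \<le> dist w v"
      using dist_snd_le[of w v] by (simp add: v dist_real_def)
    have *: "\<bar>osc j m a w\<bar> \<le> \<bar>fst w\<bar> ^ j * \<bar>snd w\<bar> * \<bar>snd w\<bar>"
    proof (cases "snd w = 0")
      case False
      have "\<bar>snd w\<bar> powi m \<le> \<bar>snd w\<bar> powi 2"
        using \<open>\<bar>snd w\<bar> \<le> dist w v\<close> w(2) False assms(2) by (intro power_int_decreasing) auto
      then have "\<bar>fst w\<bar> ^ j * \<bar>snd w\<bar> powi m * \<bar>cos (2 * pi * fst w / snd w + a)\<bar> \<le>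
          \<bar>fst w\<bar> ^ j * \<bar>snd w\<bar> powi 2 * 1"
        by (intro mult_mono mult_nonneg_nonneg abs_cos_le_one) auto
      then have "\<bar>osc j m a w\<bar> \<le> \<bar>fst w\<bar> ^ j * \<bar>snd w\<bar> ^ 2 * 1"
        using False by (simp add: osc_def case_prod_beta abs_mult power_abs power_int_abs)
      then show ?thesis by (simp add: power2_eq_square mult.assoc)
    qed (simp add: osc_def case_prod_beta)
    also have "\<dots> \<le> \<bar>fst w\<bar> ^ j * \<bar>snd w\<bar> * norm (w - v)"
      using \<open>\<bar>snd w\<bar> \<le> dist w v\<close> by (intro mult_left_mono) (auto simp: dist_norm)
    finally have "\<bar>osc j m a w\<bar> / norm (w - v) \<le> \<bar>fst w\<bar> ^ j * \<bar>snd w\<bar>"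
      using w by (simp add: divide_le_eq)
    then show "norm (osc j m a w - osc j m a v - 0) / norm (w - v) \<le> \<bar>fst w\<bar> ^ j * \<bar>snd w\<bar>"
      by (simp add: osc_def v)
  next
    have "((\<lambda>w. \<bar>fst w\<bar> ^ j * \<bar>snd w\<bar>) \<longlongrightarrow> \<bar>fst v\<bar> ^ j * \<bar>snd v\<bar>) (at v)"
      by (intro tendsto_intros)
    then show "((\<lambda>w. \<bar>fst w\<bar> ^ j * \<bar>snd w\<bar>) \<longlongrightarrow> 0) (at v)"
      by (simp add: v)
  qed auto
qed

text \<open>Each derivative lowers the exponent by at most two, so \<open>2 * int n \<le> m\<close>
  is preserved by the induction. The alternative condition lets the same induction yield smoothness
  away from the axis.\<close>

lemma osc_times_differentiable:
  assumes "open S" "2 * int n \<le> m \<or> (\<forall>v\<in>S. snd v \<noteq> 0)"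
  shows "times_differentiable_on n S (osc j m a)"
  using assms(2)
proof (induction n arbitrary: j m a)
  case (Suc n)
  have "(osc j m a has_derivative osc_deriv j m a v) (at v)" if "v \<in> S" for v
    using Suc.prems that osc_has_derivative_off_axis[of v j m a] osc_has_derivative_on_axis[of v m j a]
    by (cases "snd v = 0") auto
  then show ?case
  proof (rule times_differentiable_on_SucI[OF assms(1)])
    fix e
    have eq: "osc_deriv j m a v e = fst e * real j * osc (j - 1) m a v +
        fst e * 2 * pi * osc j (m - 1) (a + pi / 2) v +
        (snd e * of_int m * osc j (m - 1) a v +
        - snd e * 2 * pi * osc (j + 1) (m - 2) (a + pi / 2) v)" for v
      by (simp add: osc_deriv_def algebra_simps)
    show "times_differentiable_on n S (\<lambda>v. osc_deriv j m a v e)"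
      unfolding eq
      by (intro times_differentiable_on_add times_differentiable_on_mult assms(1)
          times_differentiable_on_const Suc.IH) (use Suc.prems in auto)
  qed
qed simp

section \<open>Differentiability of the pull-back\<close>

lemma phi_eq_osc: "phi k v = (osc 0 (int k) 0 v, osc 0 (int k) (- pi / 2) v, snd v)"
  by (cases v) (auto simp: phi_def osc_def cos_diff simp flip: diff_conv_add_uminus)

lemma phi_times_differentiable:
  assumes "open S" "2 * n \<le> k \<or> (\<forall>v\<in>S. snd v \<noteq> 0)" "b \<in> Basis"
  shows "times_differentiable_on n S (\<lambda>v. phi k v \<bullet> b)"
proof -
  have "times_differentiable_on n S (osc 0 (int k) a)" for a
    using assms(2) by (intro osc_times_differentiable assms(1)) auto
  moreover have "times_differentiable_on n S snd"
    by (intro times_differentiable_on_linear assms(1) bounded_linear_snd)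
  ultimately show ?thesis
    using assms(3) by (auto simp: phi_eq_osc Basis_prod_def)
qed

lemma pullback_eq: "pullback k f v = f (phi k v)"
  by (simp add: pullback_def phi_quot.abs_eq)

lemma pullback_invariant: "invariant (pullback k f)"
  unfolding invariant_def pullback_def comp_def
  by (metis plane_mod_G.abs_eq_iff)

lemma pullback_times_differentiable:
  assumes "open S" "2 * n \<le> k \<or> (\<forall>v\<in>S. snd v \<noteq> 0)" "times_differentiable_on n UNIV f"
  shows "times_differentiable_on n S (pullback k f)"
  unfolding pullback_eq[abs_def]
  by (rule times_differentiable_on_compose[where g="phi k", OF assms(1,3) phi_times_differentiable[OF assms(1,2)]])

lemma pullback_in_C_quotient:
  assumes "smooth_on UNIV f"
  shows "pullback k f \<in> carrier (C_quotient (k div 2))"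
  using assms pullback_invariant unfolding C_quotient_def function_algebra_def smooth_on_def
  by (auto intro!: pullback_times_differentiable open_off_axis)

section \<open>Comparison of the brackets on the plane and on three-space\<close>

lemma frechet_derivative_space:
  assumes "f differentiable at w"
  shows "frechet_derivative f (at w) (a, b, c) = a * dx f w + b * dy f w + c * dz f w"
proof -
  have L: "linear (frechet_derivative f (at w))"
    using assms by (rule linear_frechet_derivative)
  have "(a, b, c) = a *\<^sub>R (1, 0, 0) + b *\<^sub>R (0, 1, 0) + c *\<^sub>R (0, 0, 1::real)" by simp
  then show ?thesis
    by (simp only: linear_add[OF L] linear_scale[OF L] dx_def dy_def dz_def real_scaleR_def)
qed

lemma pullback_has_derivative:
  assumes "f differentiable at (phi k v)" "snd v \<noteq> 0"
  shows "(pullback k f has_derivative (\<lambda>e.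
    osc_deriv 0 (int k) 0 v e * dx f (phi k v) + osc_deriv 0 (int k) (- pi / 2) v e * dy f (phi k v) +
    snd e * dz f (phi k v))) (at v)"
proof -
  have phi: "(phi k has_derivative
      (\<lambda>e. (osc_deriv 0 (int k) 0 v e, osc_deriv 0 (int k) (- pi / 2) v e, snd e))) (at v)"
    unfolding phi_eq_osc[abs_def]
    by (intro has_derivative_Pair osc_has_derivative_off_axis assms(2) has_derivative_snd has_derivative_ident)
  show ?thesis
    using has_derivative_compose[OF phi differentiable_imp_has_frechet[OF assms(1)]]
    by (simp add: frechet_derivative_space[OF assms(1)] pullback_eq[abs_def])
qed

lemma F_fun_has_derivative:
  "(F_fun k has_derivative (\<lambda>(a, b, c). 2 * x * a + 2 * y * b - 2 * k * z ^ (2 * k - 1) * c)) (at (x, y, z))"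
  unfolding F_fun_def case_prod_beta
  by (auto intro!: derivative_eq_intros simp: fun_eq_iff)

lemma F_fun_derivatives:
  "dx (F_fun k) (x, y, z) = 2 * x" "dy (F_fun k) (x, y, z) = 2 * y"
  "dz (F_fun k) (x, y, z) = - 2 * k * z ^ (2 * k - 1)"
  by (simp_all add: dx_def dy_def dz_def has_derivative_imp_frechet[OF F_fun_has_derivative])

lemma pullback_space_bracket:
  assumes "k \<ge> 2" "smooth_on UNIV f" "smooth_on UNIV g"
  shows "pullback k (space_bracket k f g) v = 2 * plane_bracket (pullback k f) (pullback k g) v"
proof -
  obtain p q where v: "v = (p, q)" by (cases v)
  show ?thesis
  proof (cases "q = 0")
    case True
    \<comment> \<open>The factor \<open>q\<close> kills the plane bracket, and the gradient of
      \<open>F_fun k\<close> vanishes at the origin, so both sides are 0.\<close>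
    then have "phi k v = (0, 0, 0)" by (simp add: v phi_def)
    then show ?thesis
      using assms(1) True by (simp add: v pullback_eq plane_bracket_def space_bracket_def F_fun_derivatives power_0_left)
  next
    case False
    \<comment> \<open>With \<open>r = q ^ n\<close> the powers \<open>q ^ (k - 2)\<close>,
      \<open>q ^ (k - 1)\<close> and \<open>q ^ k\<close> become \<open>r\<close>,
      \<open>r * q\<close> and \<open>q * q * r\<close>, so only polynomial identities
      remain.\<close>
    obtain n where k: "k = n + 2" using assms(1) by (metis add.commute le_Suc_ex)
    define r c s where "r = q ^ n" and "c = cos (2 * pi * p / q)" and "s = sin (2 * pi * p / q)"
    have sc: "s * s = 1 - c * c"
      using sin_squared_eq[of "2 * pi * p / q"] by (simp add: s_def c_def power2_eq_square)
    have D: "osc_deriv 0 (int k) 0 v (1, 0) = - 2 * pi * r * q * s"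
      "osc_deriv 0 (int k) 0 v (0, 1) = k * r * q * c + 2 * pi * p * r * s"
      "osc_deriv 0 (int k) (- pi / 2) v (1, 0) = 2 * pi * r * q * c"
      "osc_deriv 0 (int k) (- pi / 2) v (0, 1) = k * r * q * s - 2 * pi * p * r * c"
      using False
      by (simp_all add: osc_deriv_def osc_def v k r_def c_def s_def cos_add cos_diff sin_diff power_int_add power_int_diff
          flip: diff_conv_add_uminus)
    have phi: "phi k v = (q * q * r * c, q * q * r * s, q)"
      using False by (simp add: v phi_def k r_def c_def s_def power_add power2_eq_square)
    have z: "q ^ (2 * k - 1) = r * r * q * q * q"
      by (simp add: k r_def mult_2 power_add numeral_eq_Suc)
    have fg: "f differentiable at w" "g differentiable at w" for w
      using assms(2,3) by (auto intro: smooth_on_imp_differentiable)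
    have nz: "snd v \<noteq> 0" using False by (simp add: v)
    note fr = has_derivative_imp_frechet[OF pullback_has_derivative[OF fg(1) nz]]
       has_derivative_imp_frechet[OF pullback_has_derivative[OF fg(2) nz]]
    have br: "plane_bracket (pullback k f) (pullback k g) v = q / (2 * pi) *
      (frechet_derivative (pullback k f) (at v) (1, 0) * frechet_derivative (pullback k g) (at v) (0, 1) -
       frechet_derivative (pullback k f) (at v) (0, 1) * frechet_derivative (pullback k g) (at v) (1, 0))"
      by (simp add: plane_bracket_def v)
    define f1 f2 f3 where "f1 = dx f (phi k v)" and "f2 = dy f (phi k v)" and "f3 = dz f (phi k v)"
    define g1 g2 g3 where "g1 = dx g (phi k v)" and "g2 = dy g (phi k v)" and "g3 = dz g (phi k v)"
    have dF: "dx (F_fun k) (phi k v) = 2 * (q * q * r * c)" "dy (F_fun k) (phi k v) = 2 * (q * q * r * s)"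
      "dz (F_fun k) (phi k v) = - 2 * k * (r * r * q * q * q)"
      unfolding phi by (simp_all only: F_fun_derivatives z)
    \<comment> \<open>\<open>J\<close> is the pulled back space bracket divided by \<open>q\<close>.
      The Jacobian expression in the plane turns out to be \<open>pi * J\<close>, and the prefactor
      \<open>q / (2 * pi)\<close> then accounts for the factor 2.\<close>
    define J where "J = 2 * q * r * (c * (f2 * g3 - f3 * g2) + s * (f3 * g1 - f1 * g3)) -
      2 * k * (r * r * q * q) * (f1 * g2 - f2 * g1)"
    have J: "frechet_derivative (pullback k f) (at v) (1, 0) * frechet_derivative (pullback k g) (at v) (0, 1) -
       frechet_derivative (pullback k f) (at v) (0, 1) * frechet_derivative (pullback k g) (at v) (1, 0) = pi * J"
    proof -
      \<comment> \<open>As an identity with independent \<open>c\<close> and \<open>s\<close>, the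
        two sides differ by a multiple of \<open>1 - c * c - s * s\<close>, which vanishes for
        cosine and sine.\<close>
      have "(2 * pi * r * q * c * f2 - 2 * pi * r * q * s * f1) *
          ((k * r * q * c + 2 * pi * p * r * s) * g1 + (k * r * q * s - 2 * pi * p * r * c) * g2 + g3) -
        ((k * r * q * c + 2 * pi * p * r * s) * f1 + (k * r * q * s - 2 * pi * p * r * c) * f2 + f3) *
          (2 * pi * r * q * c * g2 - 2 * pi * r * q * s * g1) =
        pi * J + 2 * pi * k * (r * r * q * q) * (f1 * g2 - f2 * g1) * (1 - c * c - s * s)"
        unfolding J_def by (simp add: algebra_simps)
      then show ?thesis
        unfolding fr D f1_def[symmetric] f2_def[symmetric] f3_def[symmetric]
          g1_def[symmetric] g2_def[symmetric] g3_def[symmetric]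
        by (simp add: sc)
    qed
    have "pullback k (space_bracket k f g) v = q * J"
      unfolding pullback_eq[of k "space_bracket k f g"] space_bracket_def dF
        f1_def[symmetric] f2_def[symmetric] f3_def[symmetric] g1_def[symmetric] g2_def[symmetric] g3_def[symmetric] J_def
      by (simp add: algebra_simps)
    then show ?thesis
      unfolding br J by simp
  qed
qed

section \<open>The Poisson algebra of smooth functions\<close>

lemma real_field_simps [simp]:
  "carrier real_field = UNIV" "mult real_field = (*)" "one real_field = 1"
  "zero real_field = 0" "add real_field = (+)"
  by (simp_all add: real_field_def)

lemma cring_real_field: "cring real_field"
proof (rule cringI)
  show "abelian_group real_field"
    by (rule abelian_groupI) (auto intro: exI[of _ "- x" for x])
  show "comm_monoid real_field"
    by (rule comm_monoidI) auto
qed (auto simp: algebra_simps)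

lemma function_algebra_simps [simp]:
  "carrier (function_algebra C br) = C"
  "mult (function_algebra C br) = (\<lambda>f g v. f v * g v)"
  "one (function_algebra C br) = (\<lambda>v. 1)"
  "zero (function_algebra C br) = (\<lambda>v. 0)"
  "add (function_algebra C br) = (\<lambda>f g v. f v + g v)"
  "smult (function_algebra C br) = (\<lambda>c f v. c * f v)"
  "pbracket (function_algebra C br) = br"
  by (simp_all add: function_algebra_def)

lemma rescale_function_algebra:
  "rescale_bracket c (function_algebra C br) = function_algebra C (\<lambda>f g v. c * br f g v)"
  by (simp add: rescale_bracket_def function_algebra_def)

text \<open>Serves smooth functions, the functions on the quotient, and polynomial functions alike.
  Negatives come from multiplication by the constant -1.\<close>

locale function_subalgebra =
  fixes C :: "('v \<Rightarrow> real) set"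
  assumes const: "(\<lambda>v. c) \<in> C"
    and add: "f \<in> C \<Longrightarrow> g \<in> C \<Longrightarrow> (\<lambda>v. f v + g v) \<in> C"
    and mult: "f \<in> C \<Longrightarrow> g \<in> C \<Longrightarrow> (\<lambda>v. f v * g v) \<in> C"
begin

lemma smult: "f \<in> C \<Longrightarrow> (\<lambda>v. c * f v) \<in> C"
  using mult[OF const] .

lemma diff: "f \<in> C \<Longrightarrow> g \<in> C \<Longrightarrow> (\<lambda>v. f v - g v) \<in> C"
  using add[OF _ smult[of g "-1"]] by simp

lemma algebra_function_algebra: "algebra real_field (function_algebra C br)"
proof (rule algebraI)
  show "cring (function_algebra C br)"
  proof (rule cringI)
    show "abelian_group (function_algebra C br)"
      by (rule abelian_groupI) (auto simp: algebra_simps const add intro!: bexI[OF _ smult[of _ "-1"]])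
    show "comm_monoid (function_algebra C br)"
      by (rule comm_monoidI) (auto simp: algebra_simps const mult)
  qed (auto simp: algebra_simps)
qed (auto simp: cring_real_field smult algebra_simps)

end

lemma function_subalgebra_smooth: "open S \<Longrightarrow> function_subalgebra {f. smooth_on S f}"
  by unfold_locales
     (auto simp: smooth_on_def intro!: times_differentiable_on_const times_differentiable_on_add times_differentiable_on_mult)

lemma function_subalgebra_C_quotient: "function_subalgebra (carrier (C_quotient r))"
proof -
  have inv: "invariant (\<lambda>v. c)" "invariant f \<Longrightarrow> invariant g \<Longrightarrow> invariant (\<lambda>v. f v + g v)"
    "invariant f \<Longrightarrow> invariant g \<Longrightarrow> invariant (\<lambda>v. f v * g v)" for c f g
    unfolding invariant_def by metis+
  show ?thesis
    by unfold_locales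
       (auto simp: C_quotient_def smooth_on_def open_off_axis
         intro!: inv times_differentiable_on_const times_differentiable_on_add times_differentiable_on_mult)
qed

section \<open>Partial derivatives and the Jacobi identity on three-space\<close>

lemma partial_derivatives_add:
  assumes "f differentiable at v" "g differentiable at v"
  shows "dx (\<lambda>v. f v + g v) v = dx f v + dx g v" "dy (\<lambda>v. f v + g v) v = dy f v + dy g v"
    "dz (\<lambda>v. f v + g v) v = dz f v + dz g v"
  using has_derivative_add[OF assms[THEN differentiable_imp_has_frechet], THEN has_derivative_imp_frechet]
  by (simp_all add: dx_def dy_def dz_def)

lemma partial_derivatives_diff:
  assumes "f differentiable at v" "g differentiable at v"
  shows "dx (\<lambda>v. f v - g v) v = dx f v - dx g v" "dy (\<lambda>v. f v - g v) v = dy f v - dy g v"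
    "dz (\<lambda>v. f v - g v) v = dz f v - dz g v"
  using has_derivative_diff[OF assms[THEN differentiable_imp_has_frechet], THEN has_derivative_imp_frechet]
  by (simp_all add: dx_def dy_def dz_def)

lemma partial_derivatives_mult:
  assumes "f differentiable at v" "g differentiable at v"
  shows "dx (\<lambda>v. f v * g v) v = f v * dx g v + dx f v * g v" "dy (\<lambda>v. f v * g v) v = f v * dy g v + dy f v * g v"
    "dz (\<lambda>v. f v * g v) v = f v * dz g v + dz f v * g v"
  using has_derivative_mult[OF assms[THEN differentiable_imp_has_frechet], THEN has_derivative_imp_frechet]
  by (simp_all add: dx_def dy_def dz_def)

lemma partial_derivatives_const [simp]: "dx (\<lambda>v. c) v = 0" "dy (\<lambda>v. c) v = 0" "dz (\<lambda>v. c) v = 0"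
  by (simp_all add: dx_def dy_def dz_def)

lemma smooth_partial_derivatives:
  assumes "smooth_on S f"
  shows "smooth_on S (dx f)" "smooth_on S (dy f)" "smooth_on S (dz f)"
  using smooth_on_frechet_derivative[OF assms] by (simp_all add: dx_def[abs_def] dy_def[abs_def] dz_def[abs_def])

lemma partial_derivatives_commute:
  assumes "smooth_on UNIV f"
  shows "dy (dx f) v = dx (dy f) v" "dz (dx f) v = dx (dz f) v" "dz (dy f) v = dy (dz f) v"
  using mixed_derivatives_commute[OF assms] by (simp_all add: dx_def[abs_def] dy_def[abs_def] dz_def[abs_def])

lemma coordinates_smooth:
  "smooth_on UNIV (\<lambda>v::space. fst v)" "smooth_on UNIV (\<lambda>v::space. fst (snd v))"
  "smooth_on UNIV (\<lambda>v::space. snd (snd v))"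
  by (auto simp: smooth_on_def intro!: times_differentiable_on_linear bounded_linear_intros)

lemma F_fun_smooth: "smooth_on UNIV (F_fun k)"
proof -
  interpret function_subalgebra "{f::space \<Rightarrow> real. smooth_on UNIV f}"
    by (rule function_subalgebra_smooth) simp
  have pow: "smooth_on UNIV (\<lambda>v. f v ^ n)" if "smooth_on UNIV f" for f :: "space \<Rightarrow> real" and n
    using that mult const[of 1] by (induction n) auto
  show ?thesis
    unfolding F_fun_def case_prod_beta
    using add diff pow coordinates_smooth by simp
qed

lemma space_bracket_smooth:
  assumes "smooth_on UNIV f" "smooth_on UNIV g"
  shows "smooth_on UNIV (space_bracket k f g)"
proof -
  interpret function_subalgebra "{f::space \<Rightarrow> real. smooth_on UNIV f}"
    by (rule function_subalgebra_smooth) simp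
  note d = smooth_partial_derivatives
  show ?thesis
    unfolding space_bracket_def[abs_def]
    using add diff mult d[OF assms(1)] d[OF assms(2)] d[OF F_fun_smooth] by simp
qed

text \<open>The bracket is the triple product of the gradients of \<open>F_fun k\<close>,
  \<open>f\<close> and \<open>g\<close>. After expansion by the product rule and reordering of mixed
  second derivatives, including those of \<open>F_fun k\<close>, all terms cancel.\<close>

lemma space_bracket_jacobi:
  assumes "smooth_on UNIV f" "smooth_on UNIV g" "smooth_on UNIV h"
  shows "space_bracket k f (space_bracket k g h) v + space_bracket k g (space_bracket k h f) v +
    space_bracket k h (space_bracket k f g) v = 0"
proof -
  have d: "dx h differentiable at w" "dy h differentiable at w" "dz h differentiable at w"
    if "smooth_on UNIV h" for h w
    using smooth_partial_derivatives[OF that] by (auto intro: smooth_on_imp_differentiable)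
  note smooth = assms F_fun_smooth[of k]
  note commute = smooth[THEN partial_derivatives_commute(1)] smooth[THEN partial_derivatives_commute(2)]
    smooth[THEN partial_derivatives_commute(3)]
  \<comment> \<open>The inner brackets stand under \<open>dx\<close>, \<open>dy\<close>,
    \<open>dz\<close>, so they are unfolded as functions; the outer ones are unfolded
    pointwise.\<close>
  have "space_bracket k f' g' = (\<lambda>v.
    dz (F_fun k) v * (dx f' v * dy g' v - dy f' v * dx g' v) +
    dx (F_fun k) v * (dy f' v * dz g' v - dz f' v * dy g' v) +
    dy (F_fun k) v * (dz f' v * dx g' v - dx f' v * dz g' v))" for f' g'
    by (simp add: space_bracket_def fun_eq_iff)
  note eq = this[of f g] this[of g h] this[of h f]
  show ?thesis
    unfolding space_bracket_def[of k _ "space_bracket k _ _"] unfolding eq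
    by (simp add: partial_derivatives_add partial_derivatives_diff partial_derivatives_mult
        differentiable_add differentiable_diff differentiable_mult d smooth commute,
        simp add: algebra_simps)
qed

lemma poisson_algebra_space_bracket:
  assumes "function_subalgebra C" "\<And>f. f \<in> C \<Longrightarrow> smooth_on UNIV f"
    and br: "\<And>f g. f \<in> C \<Longrightarrow> g \<in> C \<Longrightarrow> space_bracket k f g \<in> C"
  shows "poisson_algebra real_field (function_algebra C (space_bracket k))"
proof -
  interpret function_subalgebra C by fact
  have d: "f \<in> C \<Longrightarrow> f differentiable at v" for f v
    using assms(2) by (auto intro: smooth_on_imp_differentiable)
  have s: "dx (\<lambda>v. c * f v) v = c * dx f v" "dy (\<lambda>v. c * f v) v = c * dy f v" "dz (\<lambda>v. c * f v) v = c * dz f v"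
    if "f \<in> C" for f c v
    using partial_derivatives_mult[OF d[OF const] d[OF that]] by simp_all
  show ?thesis
  proof (intro poisson_algebra.intro algebra_function_algebra poisson_algebra_axioms.intro)
    fix a b c assume "a \<in> carrier (function_algebra C (space_bracket k))"
      "b \<in> carrier (function_algebra C (space_bracket k))"
      "c \<in> carrier (function_algebra C (space_bracket k))"
    then have "smooth_on UNIV a" "smooth_on UNIV b" "smooth_on UNIV c" using assms(2) by auto
    note j = space_bracket_jacobi[OF this, of k]
    let ?M = "function_algebra C (space_bracket k)"
    show "\<lbrace>a, \<lbrace>b, c\<rbrace>\<^bsub>?M\<^esub>\<rbrace>\<^bsub>?M\<^esub> \<oplus>\<^bsub>?M\<^esub> \<lbrace>b, \<lbrace>c, a\<rbrace>\<^bsub>?M\<^esub>\<rbrace>\<^bsub>?M\<^esub> \<oplus>\<^bsub>?M\<^esub> \<lbrace>c, \<lbrace>a, b\<rbrace>\<^bsub>?M\<^esub>\<rbrace>\<^bsub>?M\<^esub> = \<zero>\<^bsub>?M\<^esub>"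
      using j by simp
  qed (auto simp: br space_bracket_def fun_eq_iff d s partial_derivatives_add partial_derivatives_mult algebra_simps)
qed

section \<open>Polynomials\<close>

text \<open>Reduces claims about polynomials to the generators. The three nested layers are built
  from the inside out: first polynomials in \<open>Z\<close>, then in \<open>Y\<close>, then in
  \<open>X\<close>.\<close>

lemma poly3_induct [case_names Const X Y Z add mult]:
  fixes Pr :: "poly3 \<Rightarrow> bool"
  assumes const: "\<And>c. Pr (Const c)" and X: "Pr X" and Y: "Pr Y" and Z: "Pr Z"
    and add: "\<And>P Q. Pr P \<Longrightarrow> Pr Q \<Longrightarrow> Pr (P + Q)"
    and mult: "\<And>P Q. Pr P \<Longrightarrow> Pr Q \<Longrightarrow> Pr (P * Q)"
  shows "Pr P"
proof -
  have zero: "Pr 0" using const[of 0] by (simp add: Const_def)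
  have 1: "Pr [:[:a:]:]" for a
  proof (induction a)
    case (pCons c a)
    have "[:[:pCons c a:]:] = Const c + Z * [:[:a:]:]" by (simp add: Const_def Z_def)
    then show ?case using add[OF const mult[OF Z pCons(2)]] by simp
  qed (simp add: zero)
  have 2: "Pr [:a:]" for a
  proof (induction a)
    case (pCons c a)
    have "[:pCons c a:] = [:[:c:]:] + Y * [:a:]" by (simp add: Y_def)
    then show ?case using add[OF 1 mult[OF Y pCons(2)]] by simp
  qed (simp add: zero)
  show ?thesis
  proof (induction P)
    case (pCons c a)
    have "pCons c a = [:c:] + X * a" by (simp add: X_def)
    then show ?case using add[OF 2 mult[OF X pCons(2)]] by simp
  qed (simp add: zero)
qed

section \<open>Evaluation and formal partial derivatives\<close>

lemma poly_fun_simps [simp]: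
  "poly_fun (P + Q) v = poly_fun P v + poly_fun Q v"
  "poly_fun (P - Q) v = poly_fun P v - poly_fun Q v"
  "poly_fun (P * Q) v = poly_fun P v * poly_fun Q v"
  "poly_fun (P ^ n) v = poly_fun P v ^ n"
  "poly_fun (Const c) v = c" "poly_fun 0 v = 0" "poly_fun 1 v = 1"
  "poly_fun X v = fst v" "poly_fun Y v = fst (snd v)" "poly_fun Z v = snd (snd v)"
  by (cases v; simp add: poly_fun_def Const_def X_def Y_def Z_def)+

lemma poly_fun_F_poly: "poly_fun (F_poly k) = F_fun k"
  by (auto simp: F_poly_def F_fun_def fun_eq_iff)

text \<open>Applying a derivation coefficientwise gives a derivation again. One application to
  \<open>pderiv\<close> yields the rules for \<open>pdy\<close>, a second one those for
  \<open>pdz\<close>.\<close>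

lemma map_poly_derivation:
  fixes D :: "'a::comm_ring_1 \<Rightarrow> 'a"
  assumes add: "\<And>a b. D (a + b) = D a + D b" and mult: "\<And>a b. D (a * b) = D a * b + a * D b"
  shows "map_poly D (p + q) = map_poly D p + map_poly D q"
    "map_poly D (p * q) = map_poly D p * q + p * map_poly D q"
proof -
  have [simp]: "D 0 = 0" using add[of 0 0] by simp
  have sum: "D (\<Sum>i\<in>I. f i) = (\<Sum>i\<in>I. D (f i))" for f :: "nat \<Rightarrow> 'a" and I
    by (induction I rule: infinite_finite_induct) (simp_all add: add)
  show "map_poly D (p + q) = map_poly D p + map_poly D q"
    by (rule poly_eqI) (simp add: coeff_map_poly add)
  show "map_poly D (p * q) = map_poly D p * q + p * map_poly D q"
    by (rule poly_eqI) (simp add: coeff_map_poly coeff_mult sum mult sum.distrib)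
qed

lemma partial_simps [simp]:
  "pdx (P + Q) = pdx P + pdx Q" "pdx (P * Q) = pdx P * Q + P * pdx Q"
  "pdy (P + Q) = pdy P + pdy Q" "pdy (P * Q) = pdy P * Q + P * pdy Q"
  "pdz (P + Q) = pdz P + pdz Q" "pdz (P * Q) = pdz P * Q + P * pdz Q"
  "pdx (Const c) = 0" "pdy (Const c) = 0" "pdz (Const c) = 0"
  "pdx X = 1" "pdy X = 0" "pdz X = 0" "pdx Y = 0" "pdy Y = 1" "pdz Y = 0" "pdx Z = 0" "pdy Z = 0" "pdz Z = 1"
proof -
  have 1: "pderiv (a * b) = pderiv a * b + a * pderiv b" for a b :: "'a::{comm_ring_1,ring_no_zero_divisors} poly"
    by (simp add: pderiv_mult algebra_simps)
  note 2 = map_poly_derivation[where D=pderiv, OF pderiv_add 1]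
  note 3 = map_poly_derivation[where D="map_poly pderiv", OF 2]
  show "pdx (P + Q) = pdx P + pdx Q" "pdx (P * Q) = pdx P * Q + P * pdx Q"
    "pdy (P + Q) = pdy P + pdy Q" "pdy (P * Q) = pdy P * Q + P * pdy Q"
    "pdz (P + Q) = pdz P + pdz Q" "pdz (P * Q) = pdz P * Q + P * pdz Q"
    unfolding pdx_def pdy_def pdz_def by (simp_all only: pderiv_add 1 2 3)
  show "pdx (Const c) = 0" "pdy (Const c) = 0" "pdz (Const c) = 0"
  "pdx X = 1" "pdy X = 0" "pdz X = 0" "pdx Y = 0" "pdy Y = 1" "pdz Y = 0" "pdx Z = 0" "pdy Z = 0" "pdz Z = 1"
    by (simp_all add: pdx_def pdy_def pdz_def Const_def X_def Y_def Z_def map_poly_pCons pderiv_pCons one_pCons)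
qed

lemma poly_fun_smooth: "smooth_on UNIV (poly_fun P)"
proof -
  interpret function_subalgebra "{f::space \<Rightarrow> real. smooth_on UNIV f}"
    by (rule function_subalgebra_smooth) simp
  note sum_prod = add mult
  show ?thesis
  proof (induction P rule: poly3_induct)
    case (add P Q)
    then show ?case using sum_prod(1) by (auto simp: poly_fun_simps[abs_def])
  next
    case (mult P Q)
    then show ?case using sum_prod(2) by (auto simp: poly_fun_simps[abs_def])
  qed (use coordinates_smooth const in \<open>simp_all add: poly_fun_simps[abs_def]\<close>)
qed

lemma poly_fun_partial:
  "dx (poly_fun P) = poly_fun (pdx P)" "dy (poly_fun P) = poly_fun (pdy P)" "dz (poly_fun P) = poly_fun (pdz P)"
proof -
  \<comment> \<open>The induction is run on the total derivative, where sum and product rules apply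
    directly; the partial derivatives are read off from it.\<close>
  have *: "(poly_fun P has_derivative
     (\<lambda>(a, b, c). a * poly_fun (pdx P) v + b * poly_fun (pdy P) v + c * poly_fun (pdz P) v)) (at v)" for v
  proof (induction P rule: poly3_induct)
    case (add P Q)
    show ?case
      unfolding poly_fun_simps[abs_def]
      by (rule has_derivative_eq_rhs[OF has_derivative_add[OF add]]) (auto simp: algebra_simps)
  next
    case (mult P Q)
    show ?case
      unfolding poly_fun_simps[abs_def]
      by (rule has_derivative_eq_rhs[OF has_derivative_mult[OF mult]]) (auto simp: algebra_simps)
  qed (auto simp: poly_fun_simps[abs_def] case_prod_beta intro!: derivative_eq_intros)
  show "dx (poly_fun P) = poly_fun (pdx P)" "dy (poly_fun P) = poly_fun (pdy P)" "dz (poly_fun P) = poly_fun (pdz P)"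
    by (auto simp: dx_def dy_def dz_def has_derivative_imp_frechet[OF *])
qed

lemma poly_fun_bracket: "poly_fun (poly_bracket k P Q) = space_bracket k (poly_fun P) (poly_fun Q)"
  by (simp add: poly_bracket_def space_bracket_def fun_eq_iff poly_fun_partial flip: poly_fun_F_poly)

lemma function_subalgebra_poly_fun: "function_subalgebra (range poly_fun)"
proof
  show "(\<lambda>v. c) \<in> range poly_fun" for c
    by (rule range_eqI[of _ _ "Const c"]) (simp add: fun_eq_iff)
  show "(\<lambda>v. f v + g v) \<in> range poly_fun" if "f \<in> range poly_fun" "g \<in> range poly_fun" for f g
  proof -
    from that obtain P Q where "f = poly_fun P" "g = poly_fun Q" by auto
    then show ?thesis by (intro range_eqI[of _ _ "P + Q"]) (simp add: fun_eq_iff)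
  qed
  show "(\<lambda>v. f v * g v) \<in> range poly_fun" if "f \<in> range poly_fun" "g \<in> range poly_fun" for f g
  proof -
    from that obtain P Q where "f = poly_fun P" "g = poly_fun Q" by auto
    then show ?thesis by (intro range_eqI[of _ _ "P * Q"]) (simp add: fun_eq_iff)
  qed
qed

text \<open>Identifies the generated algebra with the image of the polynomial ring, which later
  gives surjectivity. The two inclusions are inductions over the generation of functions and of
  polynomials.\<close>

lemma generated_A_carrier: "carrier (generated_A k) = range (\<lambda>P. pullback k (poly_fun P))"
proof -
  let ?S = "{\<lambda>v. fst (phi k v), \<lambda>v. fst (snd (phi k v)), \<lambda>v. snd (snd (phi k v))}"
  have "f \<in> range (\<lambda>P. pullback k (poly_fun P))" if "f \<in> generated_algebra ?S" for f
    using that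
  proof induction
    case (const c)
    show ?case by (rule range_eqI[of _ _ "Const c"]) (simp add: fun_eq_iff pullback_eq)
  next
    case (gen f)
    then consider "f = pullback k (poly_fun X)" | "f = pullback k (poly_fun Y)" | "f = pullback k (poly_fun Z)"
      by (force simp: fun_eq_iff pullback_eq)
    then show ?case by cases auto
  next
    case (add f g)
    then obtain P Q where "f = pullback k (poly_fun P)" "g = pullback k (poly_fun Q)" by auto
    then show ?case by (intro range_eqI[of _ _ "P + Q"]) (simp add: fun_eq_iff pullback_eq)
  next
    case (mult f g)
    then obtain P Q where "f = pullback k (poly_fun P)" "g = pullback k (poly_fun Q)" by auto
    then show ?case by (intro range_eqI[of _ _ "P * Q"]) (simp add: fun_eq_iff pullback_eq)
  qed
  moreover have "pullback k (poly_fun P) \<in> generated_algebra ?S" for P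
  proof (induction P rule: poly3_induct)
    case (add P Q)
    from generated_algebra.add[OF this] show ?case by (simp add: pullback_eq[abs_def])
  next
    case (mult P Q)
    from generated_algebra.mult[OF this] show ?case by (simp add: pullback_eq[abs_def])
  qed (auto simp: pullback_eq[abs_def] intro!: generated_algebra.const generated_algebra.gen)
  ultimately show ?thesis
    by (auto simp: generated_A_def)
qed

section \<open>The kernel of the pull-back\<close>

lemma bivariate_poly_eq_0:
  fixes a :: "real poly poly"
  assumes "infinite S" "\<And>z. z \<in> S \<Longrightarrow> infinite {y. poly (poly a [:y:]) z = 0}"
  shows "a = 0"
proof -
  \<comment> \<open>Fixing z first gives a polynomial in y alone, so the infinite set of y may vary
    with z; its coefficients are then polynomials with infinitely many roots z.\<close>
  have eq: "poly (poly a [:y:]) z = poly (map_poly (\<lambda>c. poly c z) a) y" for y z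
    by (induction a) (simp_all add: map_poly_pCons)
  have "map_poly (\<lambda>c. poly c z) a = 0" if "z \<in> S" for z
    using assms(2)[OF that] poly_roots_finite[of "map_poly (\<lambda>c. poly c z) a"] by (auto simp: eq)
  then have "poly (coeff a i) z = 0" if "z \<in> S" for z i
    using that by (metis coeff_map_poly coeff_0 poly_0)
  then have "S \<subseteq> {z. poly (coeff a i) z = 0}" for i by auto
  then have "coeff a i = 0" for i
    using assms(1) poly_roots_finite finite_subset by metis
  then show ?thesis by (simp add: poly_eq_iff)
qed

text \<open>In the outermost variable, \<open>F_poly k\<close> is \<open>X\<^sup>2 + D\<close> with
  \<open>D\<close> free of \<open>X\<close>. Multiplying a remainder \<open>a + b * X\<close> by
  \<open>X\<close> therefore produces \<open>a * X - b * D\<close> modulo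
  \<open>F_poly k\<close>.\<close>

lemma division_by_F_poly: "\<exists>Q a b. P = Q * F_poly k + [:a, b:]"
proof (induction P)
  case 0
  show ?case by (intro exI[of _ 0]) simp
next
  case (pCons c P)
  then obtain Q a b where P: "P = Q * F_poly k + [:a, b:]" by blast
  define D :: "real poly poly" where "D = [:0, 1:]\<^sup>2 - [:[:0, 1:]:] ^ (2 * k)"
  have "F_poly k = [:D, 0, 1:]"
    by (simp add: F_poly_def X_def Y_def Z_def D_def power2_eq_square poly_const_pow)
  then have "[:b:] * F_poly k = [:b * D, 0, b:]" by simp
  moreover have "pCons c P = [:c:] + X * P" by (simp add: X_def)
  moreover have "X * [:a, b:] = [:0, a, b:]" by (simp add: X_def)
  ultimately have "pCons c P = (X * Q + [:b:]) * F_poly k + [:c - b * D, a:]"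
    by (simp add: P distrib_left distrib_right mult.assoc)
  then show ?case by blast
qed

lemma pullback_poly_fun_eq_0_iff:
  assumes "k > 0"
  shows "pullback k (poly_fun P) = (\<lambda>v. 0) \<longleftrightarrow> F_poly k dvd P"
proof
  have F: "poly_fun (F_poly k) (phi k v) = 0" for v
    using phi_quot_in_A_surface[OF assms, of "abs_plane_mod_G v"]
    by (auto simp: poly_fun_F_poly F_fun_def A_surface_def phi_quot.abs_eq)
  { assume "F_poly k dvd P"
    then show "pullback k (poly_fun P) = (\<lambda>v. 0)"
      by (auto simp: fun_eq_iff pullback_eq F elim!: dvdE) }
  assume P0: "pullback k (poly_fun P) = (\<lambda>v. 0)"
  obtain Q a b where P: "P = Q * F_poly k + [:a, b:]" using division_by_F_poly by blast
  \<comment> \<open>The open quarter turn keeps the cosine positive and makes the sine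
    injective.\<close>
  have ab: "poly (poly a [:z ^ k * sin t:]) z = 0 \<and> poly (poly b [:z ^ k * sin t:]) z = 0"
    if "z \<noteq> 0" "0 < t" "t < pi / 2" for z t
  proof -
    have *: "poly (poly a [:z ^ k * sin t:]) z + z ^ k * cos t * poly (poly b [:z ^ k * sin t:]) z = 0" for t
    proof -
      \<comment> \<open>This \<open>p\<close> makes the angle \<open>2 * pi * p / z\<close> equal to
        \<open>t\<close>.\<close>
      have "phi k (t * z / (2 * pi), z) = (z ^ k * cos t, z ^ k * sin t, z)"
        using \<open>z \<noteq> 0\<close> by (simp add: phi_def)
      moreover have "pullback k (poly_fun P) (t * z / (2 * pi), z) = 0" by (simp add: P0)
      ultimately show ?thesis
        using F[of "(t * z / (2 * pi), z)"] unfolding P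
        by (simp add: pullback_eq) (simp add: poly_fun_def algebra_simps)
    qed
    have "cos t > 0" using that by (intro cos_gt_zero)
    \<comment> \<open>The angles \<open>t\<close> and \<open>pi - t\<close> have the same sine and
      opposite cosines. Adding and subtracting the two equations separates \<open>a\<close> from
      \<open>b\<close>.\<close>
    then show ?thesis using *[of t] *[of "pi - t"] \<open>z \<noteq> 0\<close> by simp
  qed
  have inf: "infinite ((\<lambda>t. z ^ k * sin t) ` {0<..<pi / 2})" if "z \<noteq> 0" for z :: real
  proof
    assume "finite ((\<lambda>t. z ^ k * sin t) ` {0<..<pi / 2})"
    moreover have "inj_on (\<lambda>t. z ^ k * sin t) {0<..<pi / 2}"
      using that sin_inj_pi by (auto intro!: inj_onI)
    ultimately have "finite {0<..<pi / 2}" by (rule finite_imageD)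
    then show False by (simp add: infinite_Ioo)
  qed
  have inf': "infinite (- {0 :: real})"
    using infinite_UNIV_char_0[where 'a=real] by (simp add: Compl_eq_Diff_UNIV)
  have "a = 0"
    by (rule bivariate_poly_eq_0[OF inf'], rule infinite_super[OF _ inf]) (use ab in auto)
  moreover have "b = 0"
    by (rule bivariate_poly_eq_0[OF inf'], rule infinite_super[OF _ inf]) (use ab in auto)
  ultimately show "F_poly k dvd P" by (simp add: P)
qed

section \<open>The quotient algebra and its image\<close>

text \<open>Apart from closure and the existence of negatives, the axioms are equations between
  operations, and these pass to the image of \<open>h\<close>. Serves to carry the structure down to
  the generated algebra and from there to the quotient ring.\<close>

lemma poisson_algebra_image:
  fixes A :: "('r, 'a, 'm) poisson_scheme" and B :: "('r, 'b, 'n) poisson_scheme"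
  assumes "poisson_algebra R A" and carrier: "carrier B = h ` carrier A"
    and add: "\<And>a b. a \<in> carrier A \<Longrightarrow> b \<in> carrier A \<Longrightarrow> h (a \<oplus>\<^bsub>A\<^esub> b) = h a \<oplus>\<^bsub>B\<^esub> h b"
    and mult: "\<And>a b. a \<in> carrier A \<Longrightarrow> b \<in> carrier A \<Longrightarrow> h (a \<otimes>\<^bsub>A\<^esub> b) = h a \<otimes>\<^bsub>B\<^esub> h b"
    and one: "h \<one>\<^bsub>A\<^esub> = \<one>\<^bsub>B\<^esub>" and zero: "h \<zero>\<^bsub>A\<^esub> = \<zero>\<^bsub>B\<^esub>"
    and smult: "\<And>r a. r \<in> carrier R \<Longrightarrow> a \<in> carrier A \<Longrightarrow> h (r \<odot>\<^bsub>A\<^esub> a) = r \<odot>\<^bsub>B\<^esub> h a"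
    and bracket: "\<And>a b. a \<in> carrier A \<Longrightarrow> b \<in> carrier A \<Longrightarrow> h (\<lbrace>a, b\<rbrace>\<^bsub>A\<^esub>) = \<lbrace>h a, h b\<rbrace>\<^bsub>B\<^esub>"
  shows "poisson_algebra R B"
proof -
  interpret A: poisson_algebra R A by fact
  \<comment> \<open>Reversed, the rules gather any expression in \<open>B\<close> into
    \<open>h\<close> of one expression in \<open>A\<close>, where the axioms of \<open>A\<close>
    apply.\<close>
  note ops = add[symmetric] mult[symmetric] smult[symmetric] bracket[symmetric] one[symmetric] zero[symmetric]
  note closed = A.bracket_closed A.smult_closed
  have cring: "cring B"
  proof (rule cringI)
    show "abelian_group B"
    proof (rule abelian_groupI)
      fix x assume "x \<in> carrier B"
      then obtain a where a: "a \<in> carrier A" "x = h a" by (auto simp: carrier)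
      have "h (\<ominus>\<^bsub>A\<^esub> a) \<oplus>\<^bsub>B\<^esub> x = \<zero>\<^bsub>B\<^esub>"
        using a A.M.add.l_inv[of a] by (simp add: ops)
      then show "\<exists>y\<in>carrier B. y \<oplus>\<^bsub>B\<^esub> x = \<zero>\<^bsub>B\<^esub>"
        using a(1) by (auto simp: carrier)
    qed (auto simp: carrier ops A.M.add.m_assoc A.M.add.m_comm A.M.add.m_lcomm)
    show "comm_monoid B"
      by (rule comm_monoidI) (auto simp: carrier ops A.m_assoc A.m_comm A.m_lcomm)
  qed (auto simp: carrier ops A.l_distr)
  have "algebra R B"
    by (rule algebraI) (use cring A.R_cring in \<open>auto simp: carrier ops A.smult_l_distr A.smult_r_distr
        A.smult_assoc1 A.smult_assoc2\<close>)
  then show ?thesis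
  proof (rule poisson_algebra.intro)
    show "poisson_algebra_axioms R B"
      by (rule poisson_algebra_axioms.intro) (auto simp: carrier ops closed A.bracket_add_left A.bracket_add_right A.bracket_smult_left
          A.bracket_smult_right A.bracket_alternating A.bracket_jacobi A.bracket_leibniz)
  qed
qed

section \<open>Cosets of the ideal as fibres of the pull-back\<close>

lemma cring_poly3_ring: "cring poly3_ring"
proof (rule cringI)
  show "abelian_group poly3_ring"
    by (rule abelian_groupI) (auto simp: poly3_ring_def algebra_simps intro: exI[of _ "- x" for x])
  show "comm_monoid poly3_ring"
    by (rule comm_monoidI) (auto simp: poly3_ring_def algebra_simps)
qed (auto simp: poly3_ring_def algebra_simps)

interpretation poly3: cring poly3_ring
  by (rule cring_poly3_ring)

lemma poly3_ring_simps [simp]: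
  "carrier poly3_ring = UNIV" "mult poly3_ring = (*)" "one poly3_ring = 1"
  "zero poly3_ring = 0" "add poly3_ring = (+)"
  by (simp_all add: poly3_ring_def)

lemma ideal_F_ideal: "ideal (F_ideal k) poly3_ring"
  unfolding F_ideal_def by (rule poly3.cgenideal_ideal) simp

lemma F_ideal_eq: "F_ideal k = {P. F_poly k dvd P}"
  by (auto simp: F_ideal_def cgenideal_def dvd_def mult.commute)

lemma mem_poly_class_iff_dvd: "Q \<in> poly_class k P \<longleftrightarrow> F_poly k dvd (Q - P)"
proof -
  have "poly_class k P = {R + P | R. F_poly k dvd R}"
    by (auto simp: poly_class_def a_r_coset_def' F_ideal_eq)
  moreover have "Q = R + P \<longleftrightarrow> R = Q - P" for R by auto
  ultimately show ?thesis by auto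
qed

lemma mem_poly_class_iff:
  assumes "k > 0"
  shows "Q \<in> poly_class k P \<longleftrightarrow> pullback k (poly_fun Q) = pullback k (poly_fun P)"
proof -
  have "pullback k (poly_fun (Q - P)) = (\<lambda>v. 0) \<longleftrightarrow> pullback k (poly_fun Q) = pullback k (poly_fun P)"
    by (auto simp: pullback_eq fun_eq_iff)
  then show ?thesis
    by (simp add: mem_poly_class_iff_dvd pullback_poly_fun_eq_0_iff[OF assms, symmetric])
qed

lemma poly_class_eq_iff:
  assumes "k > 0"
  shows "poly_class k P = poly_class k Q \<longleftrightarrow> pullback k (poly_fun P) = pullback k (poly_fun Q)"
  unfolding set_eq_iff mem_poly_class_iff[OF assms] by metis

lemma poly_class_ops:
  "mult (polynomial_functions k) (poly_class k P) (poly_class k Q) = poly_class k (P * Q)"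
  "add (polynomial_functions k) (poly_class k P) (poly_class k Q) = poly_class k (P + Q)"
  "one (polynomial_functions k) = poly_class k 1" "zero (polynomial_functions k) = poly_class k 0"
  "carrier (polynomial_functions k) = range (poly_class k)"
proof -
  interpret I: ideal "F_ideal k" poly3_ring by (rule ideal_F_ideal)
  show "mult (polynomial_functions k) (poly_class k P) (poly_class k Q) = poly_class k (P * Q)"
    using I.rcoset_mult_add[of P Q] by (simp add: polynomial_functions_def FactRing_def poly_class_def Let_def)
  show "add (polynomial_functions k) (poly_class k P) (poly_class k Q) = poly_class k (P + Q)"
    using I.a_rcos_sum[of P Q] by (simp add: polynomial_functions_def FactRing_def poly_class_def Let_def)
  show "one (polynomial_functions k) = poly_class k 1"
    by (simp add: polynomial_functions_def FactRing_def poly_class_def Let_def)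
  show "zero (polynomial_functions k) = poly_class k 0"
    by (auto simp: polynomial_functions_def FactRing_def Let_def mem_poly_class_iff_dvd F_ideal_eq)
  show "carrier (polynomial_functions k) = range (poly_class k)"
    by (auto simp: polynomial_functions_def FactRing_def poly_class_def Let_def A_RCOSETS_def')
qed

text \<open>The union defining the operation runs over a nonempty coset, and all its members are the
  same set because their pull-backs agree.\<close>

lemma poly_class_smult:
  assumes "k > 0"
  shows "smult (polynomial_functions k) c (poly_class k P) = poly_class k (Const c * P)"
proof -
  have "P \<in> poly_class k P" by (simp add: mem_poly_class_iff[OF assms])
  moreover have "\<forall>P'\<in>poly_class k P. poly_class k (Const c * P') = poly_class k (Const c * P)"
    by (auto simp: mem_poly_class_iff[OF assms] poly_class_eq_iff[OF assms] pullback_eq fun_eq_iff)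
  ultimately have "(\<Union>P'\<in>poly_class k P. poly_class k (Const c * P')) = poly_class k (Const c * P)"
    by (rule UN_constant_eq)
  then show ?thesis
    by (simp add: polynomial_functions_def Let_def)
qed

lemma pullback_poly_bracket:
  assumes "k \<ge> 2"
  shows "pullback k (poly_fun (poly_bracket k P Q)) =
    (\<lambda>v. 2 * plane_bracket (pullback k (poly_fun P)) (pullback k (poly_fun Q)) v)"
  by (simp add: fun_eq_iff poly_fun_bracket pullback_space_bracket[OF assms poly_fun_smooth poly_fun_smooth])

text \<open>The pulled back bracket depends only on the pullbacks of its arguments; as cosets are the fibres
  of the pullback, the bracket of cosets is well defined.\<close>

lemma poly_class_bracket:
  assumes "k \<ge> 2"
  shows "pbracket (polynomial_functions k) (poly_class k P) (poly_class k Q) = poly_class k (poly_bracket k P Q)"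
proof -
  have k: "k > 0" using assms by simp
  have P: "P \<in> poly_class k P" "Q \<in> poly_class k Q" by (simp_all add: mem_poly_class_iff[OF k])
  have eq: "\<forall>P'\<in>poly_class k P. \<forall>Q'\<in>poly_class k Q.
      poly_class k (poly_bracket k P' Q') = poly_class k (poly_bracket k P Q)"
    by (simp add: mem_poly_class_iff[OF k] poly_class_eq_iff[OF k] pullback_poly_bracket[OF assms])
  have "(\<Union>P'\<in>poly_class k P. \<Union>Q'\<in>poly_class k Q. poly_class k (poly_bracket k P' Q')) =
      poly_class k (poly_bracket k P Q)"
    by (intro UN_constant_eq[OF P(1)] ballI UN_constant_eq[OF P(2)]) (use eq in blast)
  then show ?thesis
    by (simp add: polynomial_functions_def Let_def)
qed

text \<open>The pull-back is constant on a coset, so the image in \<open>phi_quot_star\<close> is a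
  singleton and \<open>the_elem\<close> is meaningful.\<close>

lemma phi_quot_star_poly_class:
  assumes "k > 0"
  shows "phi_quot_star k (poly_class k P) = pullback k (poly_fun P)"
proof -
  have "P \<in> poly_class k P" by (simp add: mem_poly_class_iff[OF assms])
  then have "(\<lambda>P. pullback k (poly_fun P)) ` poly_class k P = {pullback k (poly_fun P)}"
    using mem_poly_class_iff[OF assms] by auto
  then show ?thesis by (simp add: phi_quot_star_def)
qed

section \<open>Transport of the Poisson axioms\<close>

lemma poisson_algebra_poly_fun: "poisson_algebra real_field (function_algebra (range poly_fun) (space_bracket k))"
  by (rule poisson_algebra_space_bracket[OF function_subalgebra_poly_fun])
     (auto simp: poly_fun_smooth simp flip: poly_fun_bracket)

lemma generated_A_rescaled:
  "rescale_bracket 2 (generated_A k) =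
    function_algebra (range (\<lambda>P. pullback k (poly_fun P))) (\<lambda>f g v. 2 * plane_bracket f g v)"
  using generated_A_carrier[of k] by (simp add: generated_A_def rescale_function_algebra)

text \<open>The axioms, the Jacobi identity among them, are inherited from polynomial functions on
  three-space, whose bracket the pull-back respects.\<close>

lemma poisson_algebra_generated_A:
  assumes "k \<ge> 2"
  shows "poisson_algebra real_field (rescale_bracket 2 (generated_A k))"
  unfolding generated_A_rescaled
proof (rule poisson_algebra_image[OF poisson_algebra_poly_fun[of k], where h="pullback k"])
  show "pullback k (\<lbrace>f, g\<rbrace>\<^bsub>function_algebra (range poly_fun) (space_bracket k)\<^esub>) =
      \<lbrace>pullback k f, pullback k g\<rbrace>\<^bsub>function_algebra (range (\<lambda>P. pullback k (poly_fun P))) (\<lambda>f g v. 2 * plane_bracket f g v)\<^esub>"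
    if "f \<in> carrier (function_algebra (range poly_fun) (space_bracket k))"
      "g \<in> carrier (function_algebra (range poly_fun) (space_bracket k))" for f g
    using that by (auto simp: fun_eq_iff pullback_space_bracket[OF assms] poly_fun_smooth)
qed (auto simp: fun_eq_iff pullback_eq image_comp)

lemma poisson_algebra_polynomial_functions:
  assumes "k \<ge> 2"
  shows "poisson_algebra real_field (polynomial_functions k)"
proof -
  have k: "k > 0" using assms by simp
  \<comment> \<open>This is the inverse of \<open>phi_quot_star\<close>. The choice of
    \<open>P\<close> does not affect the coset, since polynomials with equal pull-backs lie in the
    same one.\<close>
  define lift where "lift f = poly_class k (SOME P. pullback k (poly_fun P) = f)" for f
  have lift: "lift (pullback k (poly_fun P)) = poly_class k P" for P
    unfolding lift_def poly_class_eq_iff[OF k] by (rule someI) (rule refl)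
  note ops = poly_class_ops poly_class_smult[OF k] poly_class_bracket[OF assms]
  have pb: "(\<lambda>v. pullback k (poly_fun P) v + pullback k (poly_fun Q) v) = pullback k (poly_fun (P + Q))"
    "(\<lambda>v. pullback k (poly_fun P) v * pullback k (poly_fun Q) v) = pullback k (poly_fun (P * Q))"
    "(\<lambda>v. c * pullback k (poly_fun P) v) = pullback k (poly_fun (Const c * P))"
    "(\<lambda>v. 1) = pullback k (poly_fun 1)" "(\<lambda>v. 0) = pullback k (poly_fun 0)" for P Q c
    by (simp_all add: fun_eq_iff pullback_eq)
  have elems: "\<And>f. f \<in> carrier (rescale_bracket 2 (generated_A k)) \<Longrightarrow> \<exists>P. f = pullback k (poly_fun P)"
    by (auto simp: generated_A_rescaled)
  show ?thesis
  proof (rule poisson_algebra_image[OF poisson_algebra_generated_A[OF assms], where h=lift])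
    show "carrier (polynomial_functions k) = lift ` carrier (rescale_bracket 2 (generated_A k))"
      by (simp add: generated_A_rescaled image_image lift ops)
  qed (auto dest!: elems, simp_all add: generated_A_rescaled pb lift ops flip: pullback_poly_bracket[OF assms])
qed

theorem proposition4p6:
  fixes k :: nat
  assumes "k \<ge> 2"
  shows "poisson_morphism real_field (C_infinity_space k)
           (rescale_bracket 2 (C_quotient (k div 2))) (pullback k) \<and>
         (\<forall>P. poly_fun P \<in> carrier (C_infinity_space k) \<and>
              phi_quot_star k (poly_class k P) = pullback k (poly_fun P)) \<and>
         poisson_isomorphism real_field (polynomial_functions k)
           (rescale_bracket 2 (generated_A k)) (phi_quot_star k)"
proof (intro conjI allI)
  have k: "k > 0" using assms by simp
  show "poly_fun P \<in> carrier (C_infinity_space k)" for P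
    by (simp add: C_infinity_space_def poly_fun_smooth)
  show "phi_quot_star k (poly_class k P) = pullback k (poly_fun P)" for P
    by (rule phi_quot_star_poly_class[OF k])
  have "poisson_algebra real_field (C_infinity_space k)"
    unfolding C_infinity_space_def
    by (rule poisson_algebra_space_bracket[OF function_subalgebra_smooth]) (auto simp: space_bracket_smooth)
  moreover have "algebra real_field (rescale_bracket 2 (C_quotient (k div 2)))"
    using function_subalgebra.algebra_function_algebra[OF function_subalgebra_C_quotient[of "k div 2"]]
    by (simp add: C_quotient_def rescale_function_algebra)
  \<comment> \<open>The bracket of two pull-backs stays in the target because it is, up to the
    rescaling, the pull-back of a smooth bracket.\<close>
  moreover have "pullback k \<in> poisson_hom real_field (C_infinity_space k) (rescale_bracket 2 (C_quotient (k div 2)))"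
    using pullback_in_C_quotient[of _ k] pullback_space_bracket[OF assms]
    by (auto simp: poisson_hom_def ring_hom_def C_infinity_space_def C_quotient_def rescale_function_algebra
        fun_eq_iff pullback_eq[of k "\<lambda>v. _ v"])
  ultimately show "poisson_morphism real_field (C_infinity_space k)
      (rescale_bracket 2 (C_quotient (k div 2))) (pullback k)"
    by (simp add: poisson_morphism_def)
  note ops = poly_class_ops poly_class_smult[OF k] poly_class_bracket[OF assms]
    phi_quot_star_poly_class[OF k]
  have "phi_quot_star k \<in> poisson_hom real_field (polynomial_functions k) (rescale_bracket 2 (generated_A k))"
    by (auto simp: poisson_hom_def ring_hom_def generated_A_rescaled ops pullback_poly_bracket[OF assms] fun_eq_iff pullback_eq)
  \<comment> \<open>Injectivity is the description of cosets as fibres; surjectivity is the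
    description of the generated algebra as an image.\<close>
  moreover have "bij_betw (phi_quot_star k) (carrier (polynomial_functions k))
      (carrier (rescale_bracket 2 (generated_A k)))"
    by (auto simp: bij_betw_def inj_on_def generated_A_rescaled ops poly_class_eq_iff[OF k] image_comp)
  ultimately show "poisson_isomorphism real_field (polynomial_functions k)
      (rescale_bracket 2 (generated_A k)) (phi_quot_star k)"
    using poisson_algebra_polynomial_functions[OF assms] poisson_algebra_generated_A[OF assms]
    by (simp add: poisson_isomorphism_def)
qed

end
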